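(* Let $A$ be a $G$-anneid, and let $R=\overline{A}$ be the corresponding graded $\Gamma$-ring, where $\Gamma=\overline{G}$. Let $J(A)$ be the Jacobson radical of $A$, $J_l(A)$ the large Jacobson radical of $A$, and $J(R)$ the Jacobson radical of the $\Gamma$-ring $R$. Then: (i) $J_l(A)=J(R)\cap A$; (ii) $J_l(A)\subseteq J(A)$.
   Context: A commutative homogroupoid is a set $H$ with a commutative partial operation $+$ (write $x\#y$, "$x,y$ are addable", if $x+y$ is defined) such that: there is $0\in H$ with $x\#0$ and $x+0=x$ for all $x$; $x\#x$ for all $x$; if $x\#y$, $y\#z$ and $y\neq0$ then $x\#z$; and for each $a\neq0$ the set $H(a)=\{x\in H: a\#x\}$ is a group under $+$ (an addibility group). Its linearization $\overline{H}$ is the direct sum of the distinct groups $H(a)$, $a\in H\setminus\{0\}$; $H$ is identified with the union of these summands. A $G$-anneid $A$ consists of commutative homogroupoids $A$ and $G$ and an everywhere defined map $A\times G\times A\to A$, $(a,\gamma,b)\mapsto a\gamma b$, such that: $a\#a'$ implies $a\gamma b\#a'\gamma b$ and $(a+a')\gamma b=a\gamma b+a'\gamma b$; $\gamma\#\gamma'$ implies $a\gamma b\#a\gamma' b$ and $a(\gamma+\gamma')b=a\gamma b+a\gamma' b$; $b\#b'$ implies $a\gamma b\#a\gamma b'$ and $a\gamma(b+b')=a\gamma b+a\gamma b'$; and $(a\gamma b)\beta c=a\gamma(b\beta c)$. The corresponding graded $\Gamma$-ring is $R=\overline{A}$ with $\Gamma=\overline{G}$ and the product $R\times\Gamma\times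 R\to R$ obtained by extending $A\times G\times A\to A$ additively in each variable. A (right) $AG$-moduloid is a commutative homogroupoid $M$ with a map $M\times G\times A\to M$, $(w,\alpha,x)\mapsto w\alpha x$, such that $x\#y$ implies $w\alpha x\#w\alpha y$ and $w\alpha(x+y)=w\alpha x+w\alpha y$; $w\#w'$ implies $w\alpha x\#w'\alpha x$ and $(w+w')\alpha x=w\alpha x+w'\alpha x$; and $w\beta(x\alpha y)=(w\beta x)\alpha y$. It is regular if for all $x\in M$, $\alpha,\beta\in G$, $a,b\in A$: $0\neq x\alpha a\#x\beta b\neq0$ implies $\alpha\#\beta$ and $a\#b$. A submoduloid of $M$ is a nonempty $N\subseteq M$ such that $x,y\in N$, $x\#y$ imply $x-y\in N$, and $x\alpha a\in N$ for all $x\in N$, $\alpha\in G$, $a\in A$. $M$ is irreducible if $MGA=\{w\alpha a\}\ne\{0\}$ and $M$ has no nontrivial submoduloids. The annihilator of $M$ is $(0:M)=\{a\in A: MGa=\{0\}\}$. The Jacobson radical $J(A)$ is the intersection of the annihilators of all irreducible regular $AG$-moduloids; the large Jacobson radical $J_l(A)$ is the intersection of the annihilators of all irreducible $AG$-moduloids (regular or not). A $\Gamma$-ring is a pair of abelian groups $R,\Gamma$ with a map $R\times\Gamma\times R\to R$, additive in each variable, with $(x\alpha y)\beta z=x\alpha(y\beta z)$. A right $R\Gamma$-module is an abelian group $V$ with a map $V\times\Gamma\times R\to V$, additive in each variable, with $(v\alpha x)\beta y=v\alpha(x\beta y)$; it is irreducible if $V\Gamma R\neq\{0\}$ and it has no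 nontrivial submodules. The Jacobson radical $J(R)$ of a $\Gamma$-ring $R$ is the intersection of the annihilators $\{a\in R: V\Gamma a=\{0\}\}$ of all irreducible right $R\Gamma$-modules $V$. *)

theory Defs
  imports "HOL-Algebra.FiniteProduct" "HOL-Algebra.Product_Groups"
begin

section \<open>Commutative homogroupoids and their linearizations\<close>

text \<open>
  A partial operation is a total HOL function together with the relation \<open>x \<sharp> y\<close>
  stating that \<open>x \<boxplus> y\<close> is defined; the value of \<open>x \<boxplus> y\<close> is irrelevant otherwise.
\<close>

record 'a homogroupoid = "'a partial_object" +
  addable :: "'a \<Rightarrow> 'a \<Rightarrow> bool" (infix \<open>\<sharp>\<index>\<close> 50)
  hadd :: "'a \<Rightarrow> 'a \<Rightarrow> 'a" (infixl \<open>\<boxplus>\<index>\<close> 65)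
  hzero :: 'a (\<open>\<zero>\<index>\<close>)

text \<open>The multiplicative record makes the group theory of HOL-Algebra applicable to \<open>\<boxplus>\<close>.\<close>

definition grp_on :: "'a homogroupoid \<Rightarrow> 'a set \<Rightarrow> 'a monoid" where
  "grp_on H S = \<lparr>carrier = S, mult = hadd H, one = hzero H\<rparr>"

definition addible :: "'a homogroupoid \<Rightarrow> 'a \<Rightarrow> 'a set" where
  "addible H a = {x \<in> carrier H. a \<sharp>\<^bsub>H\<^esub> x}"

locale comm_homogroupoid =
  fixes H :: "'a homogroupoid" (structure)
  assumes add_closed: "\<lbrakk>x \<in> carrier H; y \<in> carrier H; x \<sharp> y\<rbrakk> \<Longrightarrow> x \<boxplus> y \<in> carrier H"
    and addable_sym: "\<lbrakk>x \<in> carrier H; y \<in> carrier H; x \<sharp> y\<rbrakk> \<Longrightarrow> y \<sharp> x"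
    and add_commute: "\<lbrakk>x \<in> carrier H; y \<in> carrier H; x \<sharp> y\<rbrakk> \<Longrightarrow> x \<boxplus> y = y \<boxplus> x"
    and zero_closed: "\<zero> \<in> carrier H"
    and addable_zero: "x \<in> carrier H \<Longrightarrow> x \<sharp> \<zero>"
    and add_zero: "x \<in> carrier H \<Longrightarrow> x \<boxplus> \<zero> = x"
    and addable_refl: "x \<in> carrier H \<Longrightarrow> x \<sharp> x"
    and addable_trans: "\<lbrakk>x \<in> carrier H; y \<in> carrier H; z \<in> carrier H;
           x \<sharp> y; y \<sharp> z; y \<noteq> \<zero>\<rbrakk> \<Longrightarrow> x \<sharp> z"
    and addible_group: "\<lbrakk>a \<in> carrier H; a \<noteq> \<zero>\<rbrakk> \<Longrightarrow> group (grp_on H (addible H a))"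

text \<open>
  The opposite of \<open>y \<noteq> \<zero>\<close> is formed in its addibility group. For \<open>y = \<zero>\<close> the structure
  on \<open>addible H \<zero>\<close> is not a group, but \<open>\<zero>\<close> is still the only inverse of \<open>\<zero>\<close> in it.
\<close>

definition hneg :: "'a homogroupoid \<Rightarrow> 'a \<Rightarrow> 'a" where
  "hneg H y = inv\<^bsub>grp_on H (addible H y)\<^esub> y"

definition hminus :: "'a homogroupoid \<Rightarrow> 'a \<Rightarrow> 'a \<Rightarrow> 'a" (infixl \<open>\<boxminus>\<index>\<close> 65) where
  "x \<boxminus>\<^bsub>H\<^esub> y = x \<boxplus>\<^bsub>H\<^esub> hneg H y"

text \<open>
  Indexing by the set of addibility groups, rather than by the elements \<open>a\<close>, makes
  every distinct group occur once in the direct sum.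
\<close>

definition addgroups :: "'a homogroupoid \<Rightarrow> 'a set set" where
  "addgroups H = addible H ` (carrier H - {\<zero>\<^bsub>H\<^esub>})"

definition lin :: "'a homogroupoid \<Rightarrow> ('a set \<Rightarrow> 'a) monoid" where
  "lin H = sum_group (addgroups H) (grp_on H)"

text \<open>The identification of \<open>H\<close> with the union of the summands of its linearization.\<close>

definition emb :: "'a homogroupoid \<Rightarrow> 'a \<Rightarrow> 'a set \<Rightarrow> 'a" where
  "emb H a = (\<lambda>S\<in>addgroups H. if a \<in> S then a else \<zero>\<^bsub>H\<^esub>)"

definition lin_supp :: "'a homogroupoid \<Rightarrow> ('a set \<Rightarrow> 'a) \<Rightarrow> 'a set set" where
  "lin_supp H x = {S \<in> addgroups H. x S \<noteq> \<zero>\<^bsub>H\<^esub>}"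


section \<open>Anneids and moduloids\<close>

locale anneid = A: comm_homogroupoid A + G: comm_homogroupoid G
  for A :: "'a homogroupoid" and G :: "'g homogroupoid" +
  fixes p :: "'a \<Rightarrow> 'g \<Rightarrow> 'a \<Rightarrow> 'a"
  assumes p_closed: "\<lbrakk>a \<in> carrier A; \<gamma> \<in> carrier G; b \<in> carrier A\<rbrakk> \<Longrightarrow> p a \<gamma> b \<in> carrier A"
    and p_left: "\<lbrakk>a \<in> carrier A; a' \<in> carrier A; \<gamma> \<in> carrier G; b \<in> carrier A; a \<sharp>\<^bsub>A\<^esub> a'\<rbrakk> \<Longrightarrow>
          p a \<gamma> b \<sharp>\<^bsub>A\<^esub> p a' \<gamma> b \<and> p (a \<boxplus>\<^bsub>A\<^esub> a') \<gamma> b = p a \<gamma> b \<boxplus>\<^bsub>A\<^esub> p a' \<gamma> b"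
    and p_middle: "\<lbrakk>a \<in> carrier A; \<gamma> \<in> carrier G; \<gamma>' \<in> carrier G; b \<in> carrier A; \<gamma> \<sharp>\<^bsub>G\<^esub> \<gamma>'\<rbrakk> \<Longrightarrow>
          p a \<gamma> b \<sharp>\<^bsub>A\<^esub> p a \<gamma>' b \<and> p a (\<gamma> \<boxplus>\<^bsub>G\<^esub> \<gamma>') b = p a \<gamma> b \<boxplus>\<^bsub>A\<^esub> p a \<gamma>' b"
    and p_right: "\<lbrakk>a \<in> carrier A; \<gamma> \<in> carrier G; b \<in> carrier A; b' \<in> carrier A; b \<sharp>\<^bsub>A\<^esub> b'\<rbrakk> \<Longrightarrow>
          p a \<gamma> b \<sharp>\<^bsub>A\<^esub> p a \<gamma> b' \<and> p a \<gamma> (b \<boxplus>\<^bsub>A\<^esub> b') = p a \<gamma> b \<boxplus>\<^bsub>A\<^esub> p a \<gamma> b'"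
    and p_assoc: "\<lbrakk>a \<in> carrier A; \<gamma> \<in> carrier G; b \<in> carrier A; \<beta> \<in> carrier G; c \<in> carrier A\<rbrakk> \<Longrightarrow>
          p (p a \<gamma> b) \<beta> c = p a \<gamma> (p b \<beta> c)"

text \<open>Additivity in the \<open>G\<close>-argument is not part of the notion of a moduloid.\<close>

locale moduloid = anneid A G p + M: comm_homogroupoid M
  for A :: "'a homogroupoid" and G :: "'g homogroupoid" and p :: "'a \<Rightarrow> 'g \<Rightarrow> 'a \<Rightarrow> 'a"
    and M :: "'m homogroupoid" +
  fixes act :: "'m \<Rightarrow> 'g \<Rightarrow> 'a \<Rightarrow> 'm"
  assumes act_closed: "\<lbrakk>w \<in> carrier M; \<alpha> \<in> carrier G; x \<in> carrier A\<rbrakk> \<Longrightarrow> act w \<alpha> x \<in> carrier M"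
    and act_right: "\<lbrakk>w \<in> carrier M; \<alpha> \<in> carrier G; x \<in> carrier A; y \<in> carrier A; x \<sharp>\<^bsub>A\<^esub> y\<rbrakk> \<Longrightarrow>
          act w \<alpha> x \<sharp>\<^bsub>M\<^esub> act w \<alpha> y \<and> act w \<alpha> (x \<boxplus>\<^bsub>A\<^esub> y) = act w \<alpha> x \<boxplus>\<^bsub>M\<^esub> act w \<alpha> y"
    and act_left: "\<lbrakk>w \<in> carrier M; w' \<in> carrier M; \<alpha> \<in> carrier G; x \<in> carrier A; w \<sharp>\<^bsub>M\<^esub> w'\<rbrakk> \<Longrightarrow>
          act w \<alpha> x \<sharp>\<^bsub>M\<^esub> act w' \<alpha> x \<and> act (w \<boxplus>\<^bsub>M\<^esub> w') \<alpha> x = act w \<alpha> x \<boxplus>\<^bsub>M\<^esub> act w' \<alpha> x"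
    and act_assoc: "\<lbrakk>w \<in> carrier M; \<beta> \<in> carrier G; x \<in> carrier A; \<alpha> \<in> carrier G; y \<in> carrier A\<rbrakk> \<Longrightarrow>
          act w \<beta> (p x \<alpha> y) = act (act w \<beta> x) \<alpha> y"

definition regular_moduloid ::
    "'a homogroupoid \<Rightarrow> 'g homogroupoid \<Rightarrow> 'm homogroupoid \<Rightarrow> ('m \<Rightarrow> 'g \<Rightarrow> 'a \<Rightarrow> 'm) \<Rightarrow> bool" where
  "regular_moduloid A G M act \<longleftrightarrow>
     (\<forall>x\<in>carrier M. \<forall>\<alpha>\<in>carrier G. \<forall>\<beta>\<in>carrier G. \<forall>a\<in>carrier A. \<forall>b\<in>carrier A.
        \<zero>\<^bsub>M\<^esub> \<noteq> act x \<alpha> a \<and> act x \<alpha> a \<sharp>\<^bsub>M\<^esub> act x \<beta> b \<and> act x \<beta> b \<noteq> \<zero>\<^bsub>M\<^esub> \<longrightarrow>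
        \<alpha> \<sharp>\<^bsub>G\<^esub> \<beta> \<and> a \<sharp>\<^bsub>A\<^esub> b)"

definition submoduloid ::
    "'m set \<Rightarrow> 'a homogroupoid \<Rightarrow> 'g homogroupoid \<Rightarrow> 'm homogroupoid \<Rightarrow> ('m \<Rightarrow> 'g \<Rightarrow> 'a \<Rightarrow> 'm) \<Rightarrow> bool" where
  "submoduloid N A G M act \<longleftrightarrow> N \<noteq> {} \<and> N \<subseteq> carrier M \<and>
     (\<forall>x\<in>N. \<forall>y\<in>N. x \<sharp>\<^bsub>M\<^esub> y \<longrightarrow> x \<boxminus>\<^bsub>M\<^esub> y \<in> N) \<and>
     (\<forall>x\<in>N. \<forall>\<alpha>\<in>carrier G. \<forall>a\<in>carrier A. act x \<alpha> a \<in> N)"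

definition irreducible_moduloid ::
    "'a homogroupoid \<Rightarrow> 'g homogroupoid \<Rightarrow> ('a \<Rightarrow> 'g \<Rightarrow> 'a \<Rightarrow> 'a) \<Rightarrow>
     'm homogroupoid \<Rightarrow> ('m \<Rightarrow> 'g \<Rightarrow> 'a \<Rightarrow> 'm) \<Rightarrow> bool" where
  "irreducible_moduloid A G p M act \<longleftrightarrow> moduloid A G p M act \<and>
     {act w \<alpha> a |w \<alpha> a. w \<in> carrier M \<and> \<alpha> \<in> carrier G \<and> a \<in> carrier A} \<noteq> {\<zero>\<^bsub>M\<^esub>} \<and>
     (\<forall>N. submoduloid N A G M act \<longrightarrow> N = {\<zero>\<^bsub>M\<^esub>} \<or> N = carrier M)"

definition moduloid_ann ::
    "'a homogroupoid \<Rightarrow> 'g homogroupoid \<Rightarrow> 'm homogroupoid \<Rightarrow> ('m \<Rightarrow> 'g \<Rightarrow> 'a \<Rightarrow> 'm) \<Rightarrow> 'a set" where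
  "moduloid_ann A G M act =
     {a \<in> carrier A. {act w \<alpha> a |w \<alpha>. w \<in> carrier M \<and> \<alpha> \<in> carrier G} = {\<zero>\<^bsub>M\<^esub>}}"

text \<open>
  HOL cannot quantify over the type of the elements of \<open>M\<close> inside a definition, so the
  radicals range over moduloids carried by the type \<^typ>\<open>'a list\<close>. This loses nothing:
  an irreducible moduloid over any type has an isomorphic copy carried by \<^typ>\<open>'a list\<close>.
  The lemmas \<open>large_jacobson_radical_any_type\<close> and \<open>jacobson_radical_any_type\<close> below show that
  the elements of the radicals annihilate the irreducible moduloids of every type.
\<close>

definition jacobson_radical ::
    "'a homogroupoid \<Rightarrow> 'g homogroupoid \<Rightarrow> ('a \<Rightarrow> 'g \<Rightarrow> 'a \<Rightarrow> 'a) \<Rightarrow> 'a set" where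
  "jacobson_radical A G p = {a \<in> carrier A. \<forall>(M :: 'a list homogroupoid) act.
     irreducible_moduloid A G p M act \<and> regular_moduloid A G M act \<longrightarrow> a \<in> moduloid_ann A G M act}"

definition large_jacobson_radical ::
    "'a homogroupoid \<Rightarrow> 'g homogroupoid \<Rightarrow> ('a \<Rightarrow> 'g \<Rightarrow> 'a \<Rightarrow> 'a) \<Rightarrow> 'a set" where
  "large_jacobson_radical A G p = {a \<in> carrier A. \<forall>(M :: 'a list homogroupoid) act.
     irreducible_moduloid A G p M act \<longrightarrow> a \<in> moduloid_ann A G M act}"


section \<open>\<open>\<Gamma>\<close>-rings\<close>

text \<open>Abelian groups are the \<^const>\<open>comm_group\<close>s of HOL-Algebra, hence written multiplicatively.\<close>

locale gamma_ring = R: comm_group R + \<Gamma>: comm_group \<Gamma>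
  for R :: "'r monoid" and \<Gamma> :: "'c monoid" +
  fixes q :: "'r \<Rightarrow> 'c \<Rightarrow> 'r \<Rightarrow> 'r"
  assumes q_closed: "\<lbrakk>x \<in> carrier R; \<alpha> \<in> carrier \<Gamma>; y \<in> carrier R\<rbrakk> \<Longrightarrow> q x \<alpha> y \<in> carrier R"
    and q_left: "\<lbrakk>x \<in> carrier R; x' \<in> carrier R; \<alpha> \<in> carrier \<Gamma>; y \<in> carrier R\<rbrakk> \<Longrightarrow>
          q (x \<otimes>\<^bsub>R\<^esub> x') \<alpha> y = q x \<alpha> y \<otimes>\<^bsub>R\<^esub> q x' \<alpha> y"
    and q_middle: "\<lbrakk>x \<in> carrier R; \<alpha> \<in> carrier \<Gamma>; \<alpha>' \<in> carrier \<Gamma>; y \<in> carrier R\<rbrakk> \<Longrightarrow>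
          q x (\<alpha> \<otimes>\<^bsub>\<Gamma>\<^esub> \<alpha>') y = q x \<alpha> y \<otimes>\<^bsub>R\<^esub> q x \<alpha>' y"
    and q_right: "\<lbrakk>x \<in> carrier R; \<alpha> \<in> carrier \<Gamma>; y \<in> carrier R; y' \<in> carrier R\<rbrakk> \<Longrightarrow>
          q x \<alpha> (y \<otimes>\<^bsub>R\<^esub> y') = q x \<alpha> y \<otimes>\<^bsub>R\<^esub> q x \<alpha> y'"
    and q_assoc: "\<lbrakk>x \<in> carrier R; \<alpha> \<in> carrier \<Gamma>; y \<in> carrier R; \<beta> \<in> carrier \<Gamma>; z \<in> carrier R\<rbrakk> \<Longrightarrow>
          q (q x \<alpha> y) \<beta> z = q x \<alpha> (q y \<beta> z)"

locale gamma_module = gamma_ring R \<Gamma> q + V: comm_group V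
  for R :: "'r monoid" and \<Gamma> :: "'c monoid" and q :: "'r \<Rightarrow> 'c \<Rightarrow> 'r \<Rightarrow> 'r" and V :: "'v monoid" +
  fixes act :: "'v \<Rightarrow> 'c \<Rightarrow> 'r \<Rightarrow> 'v"
  assumes act_closed: "\<lbrakk>v \<in> carrier V; \<alpha> \<in> carrier \<Gamma>; x \<in> carrier R\<rbrakk> \<Longrightarrow> act v \<alpha> x \<in> carrier V"
    and act_left: "\<lbrakk>v \<in> carrier V; v' \<in> carrier V; \<alpha> \<in> carrier \<Gamma>; x \<in> carrier R\<rbrakk> \<Longrightarrow>
          act (v \<otimes>\<^bsub>V\<^esub> v') \<alpha> x = act v \<alpha> x \<otimes>\<^bsub>V\<^esub> act v' \<alpha> x"
    and act_middle: "\<lbrakk>v \<in> carrier V; \<alpha> \<in> carrier \<Gamma>; \<alpha>' \<in> carrier \<Gamma>; x \<in> carrier R\<rbrakk> \<Longrightarrow>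
          act v (\<alpha> \<otimes>\<^bsub>\<Gamma>\<^esub> \<alpha>') x = act v \<alpha> x \<otimes>\<^bsub>V\<^esub> act v \<alpha>' x"
    and act_right: "\<lbrakk>v \<in> carrier V; \<alpha> \<in> carrier \<Gamma>; x \<in> carrier R; x' \<in> carrier R\<rbrakk> \<Longrightarrow>
          act v \<alpha> (x \<otimes>\<^bsub>R\<^esub> x') = act v \<alpha> x \<otimes>\<^bsub>V\<^esub> act v \<alpha> x'"
    and act_assoc: "\<lbrakk>v \<in> carrier V; \<alpha> \<in> carrier \<Gamma>; x \<in> carrier R; \<beta> \<in> carrier \<Gamma>; y \<in> carrier R\<rbrakk> \<Longrightarrow>
          act (act v \<alpha> x) \<beta> y = act v \<alpha> (q x \<beta> y)"

definition gamma_submodule ::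
    "'v set \<Rightarrow> 'r monoid \<Rightarrow> 'c monoid \<Rightarrow> 'v monoid \<Rightarrow> ('v \<Rightarrow> 'c \<Rightarrow> 'r \<Rightarrow> 'v) \<Rightarrow> bool" where
  "gamma_submodule U R \<Gamma> V act \<longleftrightarrow> subgroup U V \<and>
     (\<forall>u\<in>U. \<forall>\<alpha>\<in>carrier \<Gamma>. \<forall>x\<in>carrier R. act u \<alpha> x \<in> U)"

definition irreducible_gamma_module ::
    "'r monoid \<Rightarrow> 'c monoid \<Rightarrow> ('r \<Rightarrow> 'c \<Rightarrow> 'r \<Rightarrow> 'r) \<Rightarrow> 'v monoid \<Rightarrow> ('v \<Rightarrow> 'c \<Rightarrow> 'r \<Rightarrow> 'v) \<Rightarrow> bool" where
  "irreducible_gamma_module R \<Gamma> q V act \<longleftrightarrow> gamma_module R \<Gamma> q V act \<and>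
     {act v \<alpha> x |v \<alpha> x. v \<in> carrier V \<and> \<alpha> \<in> carrier \<Gamma> \<and> x \<in> carrier R} \<noteq> {\<one>\<^bsub>V\<^esub>} \<and>
     (\<forall>U. gamma_submodule U R \<Gamma> V act \<longrightarrow> U = {\<one>\<^bsub>V\<^esub>} \<or> U = carrier V)"

definition gamma_module_ann ::
    "'r monoid \<Rightarrow> 'c monoid \<Rightarrow> 'v monoid \<Rightarrow> ('v \<Rightarrow> 'c \<Rightarrow> 'r \<Rightarrow> 'v) \<Rightarrow> 'r set" where
  "gamma_module_ann R \<Gamma> V act =
     {a \<in> carrier R. {act v \<alpha> a |v \<alpha>. v \<in> carrier V \<and> \<alpha> \<in> carrier \<Gamma>} = {\<one>\<^bsub>V\<^esub>}}"

text \<open>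
  As for moduloids, the type of the elements of \<open>V\<close> has to be fixed. The type of \<open>R\<close> is large
  enough, since an irreducible \<open>V\<close> is of the form \<open>v \<alpha> R\<close>; see
  \<open>gamma_jacobson_radical_any_type\<close> below.
\<close>

definition gamma_jacobson_radical ::
    "'r monoid \<Rightarrow> 'c monoid \<Rightarrow> ('r \<Rightarrow> 'c \<Rightarrow> 'r \<Rightarrow> 'r) \<Rightarrow> 'r set" where
  "gamma_jacobson_radical R \<Gamma> q = {a \<in> carrier R. \<forall>(V :: 'r monoid) act.
     irreducible_gamma_module R \<Gamma> q V act \<longrightarrow> a \<in> gamma_module_ann R \<Gamma> V act}"


section \<open>The graded \<open>\<Gamma>\<close>-ring of an anneid\<close>

text \<open>
  The triadditive extension of \<^term>\<open>p\<close>: the sum in \<^term>\<open>lin A\<close> of the products of the homogeneous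
  components. The lemmas \<open>lin_prod_emb\<close> and \<open>gamma_ring_lin\<close> below justify the name.
\<close>

definition lin_prod ::
    "'a homogroupoid \<Rightarrow> 'g homogroupoid \<Rightarrow> ('a \<Rightarrow> 'g \<Rightarrow> 'a \<Rightarrow> 'a) \<Rightarrow>
     ('a set \<Rightarrow> 'a) \<Rightarrow> ('g set \<Rightarrow> 'g) \<Rightarrow> ('a set \<Rightarrow> 'a) \<Rightarrow> 'a set \<Rightarrow> 'a" where
  "lin_prod A G p x \<gamma> y = finprod (lin A) (\<lambda>(S, T, U). emb A (p (x S) (\<gamma> T) (y U)))
     (lin_supp A x \<times> lin_supp G \<gamma> \<times> lin_supp A y)"


subsection \<open>\<^const>\<open>lin_prod\<close> makes the linearization a \<open>\<Gamma>\<close>-ring\<close>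

context comm_homogroupoid begin

lemma addible_subset: "addible H a \<subseteq> carrier H"
  by (auto simp: addible_def)

lemma addible_pair: "\<lbrakk>a \<in> carrier H; a \<noteq> \<zero>; x \<in> addible H a; y \<in> addible H a\<rbrakk> \<Longrightarrow> x \<sharp> y"
  using addable_trans[of x a y] addable_sym[of a x] by (simp add: addible_def)

lemma mem_addible_self: "a \<in> carrier H \<Longrightarrow> a \<in> addible H a"
  by (simp add: addible_def addable_refl)

lemma zero_in_addible: "a \<in> carrier H \<Longrightarrow> \<zero> \<in> addible H a"
  by (simp add: addible_def zero_closed addable_zero)

lemma addible_eq:
  assumes "a \<in> carrier H" "a \<noteq> \<zero>" "b \<in> carrier H" "b \<noteq> \<zero>" "a \<sharp> b"
  shows "addible H a = addible H b"
proof -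
  have "a \<sharp> x \<longleftrightarrow> b \<sharp> x" if x: "x \<in> carrier H" for x
    using assms(1-4) addable_trans[OF assms(3,1) x] addable_trans[OF assms(1,3) x]
      addable_sym[OF assms(1,3,5)] assms(5) by blast
  then show ?thesis unfolding addible_def by blast
qed

lemma grp_on_simps [simp]:
  "carrier (grp_on H S) = S" "mult (grp_on H S) = hadd H" "one (grp_on H S) = \<zero>"
  by (simp_all add: grp_on_def)

lemma zero_add: "x \<in> carrier H \<Longrightarrow> \<zero> \<boxplus> x = x"
  using add_commute add_zero addable_zero zero_closed by metis

lemma hneg_eqI:
  assumes y: "y \<in> carrier H" and z: "z \<in> carrier H" "y \<sharp> z" "y \<boxplus> z = \<zero>"
  shows "hneg H y = z"
proof (cases "y = \<zero>")
  case True
  then have "z = \<zero>" using z zero_add by simp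
  have "(THE w. w \<in> addible H y \<and> y \<boxplus> w = \<zero> \<and> w \<boxplus> y = \<zero>) = z"
  proof (rule the_equality)
    show "z \<in> addible H y \<and> y \<boxplus> z = \<zero> \<and> z \<boxplus> y = \<zero>"
      using True \<open>z = \<zero>\<close> zero_in_addible[OF zero_closed] add_zero[OF zero_closed] by simp
    fix w assume w: "w \<in> addible H y \<and> y \<boxplus> w = \<zero> \<and> w \<boxplus> y = \<zero>"
    then have "w \<in> carrier H" using addible_subset by blast
    then show "w = z" using add_zero[of w] w True \<open>z = \<zero>\<close> by simp
  qed
  then show ?thesis by (simp add: hneg_def m_inv_def)
next
  case False
  interpret g: group "grp_on H (addible H y)" by (rule addible_group[OF y False])
  have "z \<in> addible H y" using z by (simp add: addible_def)
  moreover have "z \<boxplus> y = \<zero>" using z add_commute[OF y z(1,2)] by simp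
  ultimately show ?thesis using g.inv_equality[of z y] mem_addible_self[OF y] by (simp add: hneg_def)
qed

lemma hneg_ex: "y \<in> carrier H \<Longrightarrow> \<exists>z\<in>carrier H. y \<sharp> z \<and> y \<boxplus> z = \<zero>"
proof (cases "y = \<zero>")
  case True
  then show ?thesis using zero_closed addable_zero add_zero by auto
next
  case False
  assume y: "y \<in> carrier H"
  interpret g: group "grp_on H (addible H y)" by (rule addible_group[OF y False])
  show ?thesis using g.r_inv_ex[of y] mem_addible_self[OF y] by (auto simp: addible_def)
qed

lemma hneg_props: 
  assumes "y \<in> carrier H" shows "hneg H y \<in> carrier H" "y \<sharp> hneg H y" "y \<boxplus> hneg H y = \<zero>"
  using hneg_ex[OF assms] hneg_eqI[OF assms] by auto

lemma addable_hneg: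
  assumes "x \<in> carrier H" "y \<in> carrier H" "x \<sharp> y" shows "x \<sharp> hneg H y"
proof (cases "y = \<zero>")
  case True
  then show ?thesis using assms hneg_eqI[of \<zero> \<zero>] addable_zero add_zero zero_closed by metis
next
  case False
  then show ?thesis using assms hneg_props[of y] addable_trans by blast
qed

lemma hminus_closed: "\<lbrakk>x \<in> carrier H; y \<in> carrier H; x \<sharp> y\<rbrakk> \<Longrightarrow> x \<boxminus> y \<in> carrier H"
  by (simp add: hminus_def add_closed addable_hneg hneg_props)

lemma add_idem_zero: assumes "x \<in> carrier H" "x \<boxplus> x = x" shows "x = \<zero>"
proof (rule ccontr)
  assume n: "x \<noteq> \<zero>"
  interpret g: group "grp_on H (addible H x)" using assms n addible_group by auto
  show False using g.r_cancel_one[of x x] assms n mem_addible_self by simp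
qed

lemma addgroups_iff: "S \<in> addgroups H \<longleftrightarrow> (\<exists>a\<in>carrier H. a \<noteq> \<zero> \<and> S = addible H a)"
  by (auto simp: addgroups_def)

lemma addgroups_comm_group: 
  assumes "S \<in> addgroups H" shows "comm_group (grp_on H S)"
proof -
  obtain a where a: "a \<in> carrier H" "a \<noteq> \<zero>" "S = addible H a" using assms addgroups_iff by auto
  interpret group "grp_on H S" using a addible_group by simp
  show ?thesis
    by (rule group_comm_groupI)
       (use a in \<open>auto intro!: add_commute addible_pair dest: subsetD[OF addible_subset]\<close>)
qed

lemma addgroups_group: "S \<in> addgroups H \<Longrightarrow> group (grp_on H S)"
  using addgroups_comm_group comm_group.axioms(2) by blast

lemma carrier_lin: "carrier (lin H) = {x \<in> \<Pi>\<^sub>E S\<in>addgroups H. S. finite (lin_supp H x)}"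
  unfolding lin_def lin_supp_def by (subst carrier_sum_group) (auto simp: addgroups_group)

lemma one_lin: "\<one>\<^bsub>lin H\<^esub> = (\<lambda>S\<in>addgroups H. \<zero>)"
  by (simp add: lin_def)

lemma mult_lin: "x \<otimes>\<^bsub>lin H\<^esub> y = (\<lambda>S\<in>addgroups H. x S \<boxplus> y S)"
  by (simp add: lin_def)

lemma comm_group_lin: "comm_group (lin H)"
proof -
  interpret group "lin H" unfolding lin_def by (simp add: addgroups_group)
  show ?thesis
  proof (rule group_comm_groupI)
    fix x y assume x: "x \<in> carrier (lin H)" and y: "y \<in> carrier (lin H)"
    have "x S \<boxplus> y S = y S \<boxplus> x S" if "S \<in> addgroups H" for S
    proof -
      interpret S: comm_group "grp_on H S" using that by (rule addgroups_comm_group)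
      have "x S \<in> S" "y S \<in> S" using x y that by (auto simp: carrier_lin)
      then show ?thesis using S.m_comm by simp
    qed
    then show "x \<otimes>\<^bsub>lin H\<^esub> y = y \<otimes>\<^bsub>lin H\<^esub> x" by (auto simp: mult_lin)
  qed
qed

lemma addgroups_mem_iff:
  assumes "S \<in> addgroups H" "a \<in> carrier H" "a \<noteq> \<zero>"
  shows "a \<in> S \<longleftrightarrow> S = addible H a"
proof -
  obtain c where c: "c \<in> carrier H" "c \<noteq> \<zero>" "S = addible H c" using assms addgroups_iff by auto
  show ?thesis using addible_eq[of c a] c assms mem_addible_self by (auto simp: addible_def)
qed

lemma zero_in_addgroups: "S \<in> addgroups H \<Longrightarrow> \<zero> \<in> S"
  using addgroups_iff zero_in_addible by auto

lemma addgroups_subset: "S \<in> addgroups H \<Longrightarrow> S \<subseteq> carrier H"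
  using addgroups_iff addible_subset by auto

lemma lin_mem:
  assumes "x \<in> carrier (lin H)" "S \<in> addgroups H" shows "x S \<in> S" "x S \<in> carrier H"
  using assms addgroups_subset by (auto simp: carrier_lin)

lemma lin_supp_emb:
  assumes "a \<in> carrier H"
  shows "lin_supp H (emb H a) = (if a = \<zero> then {} else {addible H a})"
  using addgroups_mem_iff[OF _ assms] addgroups_iff assms
  by (auto simp: lin_supp_def emb_def mem_addible_self)

lemma emb_addible: "\<lbrakk>a \<in> carrier H; a \<noteq> \<zero>\<rbrakk> \<Longrightarrow> emb H a (addible H a) = a"
  using mem_addible_self addgroups_iff by (auto simp: emb_def)

lemma emb_closed: "a \<in> carrier H \<Longrightarrow> emb H a \<in> carrier (lin H)"
  by (simp add: carrier_lin lin_supp_emb) (auto simp: emb_def zero_in_addgroups)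

lemma emb_zero: "emb H \<zero> = \<one>\<^bsub>lin H\<^esub>"
  by (auto simp: emb_def one_lin)

lemma inj_on_emb: "inj_on (emb H) (carrier H)"
proof (rule inj_onI)
  fix a b assume ab: "a \<in> carrier H" "b \<in> carrier H" "emb H a = emb H b"
  then have *: "(if a = \<zero> then {} else {addible H a}) = (if b = \<zero> then {} else {addible H b})"
    using lin_supp_emb[of a] lin_supp_emb[of b] by simp
  show "a = b"
  proof (cases "a = \<zero>")
    case True
    then show ?thesis using * by (metis insert_not_empty)
  next
    case False
    then have b: "b \<noteq> \<zero>" using * by (metis insert_not_empty)
    then have "addible H a = addible H b" using * False by simp
    then have "emb H b (addible H b) = emb H a (addible H a)" using ab(3) by simp
    then show ?thesis using emb_addible[OF ab(1) False] emb_addible[OF ab(2) b] by simp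
  qed
qed

lemma emb_add:
  assumes a: "a \<in> carrier H" and b: "b \<in> carrier H" and ab: "a \<sharp> b"
  shows "emb H (a \<boxplus> b) = emb H a \<otimes>\<^bsub>lin H\<^esub> emb H b"
proof -
  have "emb H (a \<boxplus> b) S = emb H a S \<boxplus> emb H b S" if S: "S \<in> addgroups H" for S
  proof -
    interpret S: comm_group "grp_on H S" using S by (rule addgroups_comm_group)
    consider "a = \<zero>" | "b = \<zero>" | "a \<noteq> \<zero>" "b \<noteq> \<zero>" by blast
    then show ?thesis
    proof cases
      case 1 then show ?thesis using S b by (auto simp: emb_def zero_add zero_closed)
    next
      case 2 then show ?thesis using S a by (auto simp: emb_def add_zero zero_closed)
    next
      case 3
      have eq: "a \<in> S \<longleftrightarrow> b \<in> S"
        using addgroups_mem_iff[OF S] 3 a b addible_eq[OF a 3(1) b 3(2) ab] by simp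
      show ?thesis
      proof (cases "a \<in> S")
        case True
        then show ?thesis using eq S S.m_closed[of a b] by (simp add: emb_def)
      next
        case False
        interpret g: group "grp_on H (addible H a)" by (rule addible_group[OF a 3(1)])
        have "a \<boxplus> b \<in> addible H a"
          using g.m_closed[of a b] mem_addible_self[OF a] b ab by (simp add: addible_def)
        then have "a \<boxplus> b \<in> S \<Longrightarrow> a \<boxplus> b = \<zero>"
          using addgroups_mem_iff[OF S a 3(1)] addgroups_mem_iff[OF S, of "a \<boxplus> b"]
            addgroups_mem_iff[of "addible H a" "a \<boxplus> b"] False add_closed[OF a b ab] addgroups_iff a 3
          by blast
        then show ?thesis using False eq S by (auto simp: emb_def add_zero zero_closed)
      qed
    qed
  qed
  then show ?thesis by (auto simp: mult_lin emb_def)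
qed

lemma lin_induct [consumes 1, case_names emb add]:
  assumes x: "x \<in> carrier (lin H)"
    and e: "\<And>a. a \<in> carrier H \<Longrightarrow> P (emb H a)"
    and m: "\<And>x y. \<lbrakk>x \<in> carrier (lin H); y \<in> carrier (lin H); P x; P y\<rbrakk> \<Longrightarrow> P (x \<otimes>\<^bsub>lin H\<^esub> y)"
  shows "P x"
  using x
proof (induction "card (lin_supp H x)" arbitrary: x rule: less_induct)
  case less
  have fin: "finite (lin_supp H x)" using less.prems by (simp add: carrier_lin)
  show ?case
  proof (cases "lin_supp H x = {}")
    case True
    have "x = \<one>\<^bsub>lin H\<^esub>"
    proof
      fix S show "x S = \<one>\<^bsub>lin H\<^esub> S"
        using True less.prems PiE_arb[of x "addgroups H" "\<lambda>S. S" S]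
        by (cases "S \<in> addgroups H") (auto simp: lin_supp_def one_lin carrier_lin)
    qed
    then show ?thesis using e[OF zero_closed] emb_zero by simp
  next
    case False
    then obtain S where S: "S \<in> lin_supp H x" by auto
    then have SI: "S \<in> addgroups H" "x S \<noteq> \<zero>" by (auto simp: lin_supp_def)
    note xS = lin_mem[OF less.prems SI(1)]
    define y where "y = x(S := \<zero>)"
    have supp: "lin_supp H y = lin_supp H x - {S}" by (auto simp: lin_supp_def y_def)
    have y: "y \<in> carrier (lin H)"
      using less.prems fin SI unfolding carrier_lin supp[symmetric] mem_Collect_eq
      by (auto simp: y_def supp[unfolded y_def] PiE_iff zero_in_addgroups extensional_def)
    have "card (lin_supp H y) < card (lin_supp H x)"
      using supp S fin by (metis card_Diff1_less)
    then have Py: "P y" using less.hyps y by blast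
    have "x = emb H (x S) \<otimes>\<^bsub>lin H\<^esub> y"
    proof
      fix T show "x T = (emb H (x S) \<otimes>\<^bsub>lin H\<^esub> y) T"
      proof (cases "T \<in> addgroups H")
        case True
        have "x S \<in> T \<longleftrightarrow> T = S" using True addgroups_mem_iff xS SI by metis
        then show ?thesis using True xS lin_mem[OF less.prems True]
          by (auto simp: mult_lin emb_def y_def add_zero zero_add)
      qed (use less.prems PiE_arb[of x "addgroups H" "\<lambda>S. S" T] in \<open>simp add: mult_lin carrier_lin\<close>)
    qed
    then show ?thesis using m[OF emb_closed[OF xS(2)] y e[OF xS(2)] Py] by simp
  qed
qed

end

context anneid begin

interpretation L: comm_group "lin A" by (rule A.comm_group_lin)
interpretation LG: comm_group "lin G" by (rule G.comm_group_lin)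

lemma p_zero:
  assumes "a \<in> carrier A" "\<gamma> \<in> carrier G" "b \<in> carrier A"
  shows "p \<zero>\<^bsub>A\<^esub> \<gamma> b = \<zero>\<^bsub>A\<^esub>" "p a \<zero>\<^bsub>G\<^esub> b = \<zero>\<^bsub>A\<^esub>" "p a \<gamma> \<zero>\<^bsub>A\<^esub> = \<zero>\<^bsub>A\<^esub>"
  using p_left[of "\<zero>\<^bsub>A\<^esub>" "\<zero>\<^bsub>A\<^esub>" \<gamma> b] p_middle[of a "\<zero>\<^bsub>G\<^esub>" "\<zero>\<^bsub>G\<^esub>" b] p_right[of a \<gamma> "\<zero>\<^bsub>A\<^esub>" "\<zero>\<^bsub>A\<^esub>"]
    assms A.zero_closed G.zero_closed A.addable_zero G.addable_zero A.add_zero G.add_zero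
  by (metis A.add_idem_zero p_closed)+

abbreviation summand where
  "summand x \<gamma> y \<equiv> (\<lambda>(S, T, U). emb A (p (x S) (\<gamma> T) (y U)))"

lemma summand_closed:
  assumes "x \<in> carrier (lin A)" "\<gamma> \<in> carrier (lin G)" "y \<in> carrier (lin A)"
    "I \<subseteq> addgroups A" "J \<subseteq> addgroups G" "K \<subseteq> addgroups A"
  shows "summand x \<gamma> y \<in> I \<times> J \<times> K \<rightarrow> carrier (lin A)"
proof (rule Pi_I)
  fix t assume "t \<in> I \<times> J \<times> K"
  then obtain S T U where t: "t = (S, T, U)" "S \<in> addgroups A" "T \<in> addgroups G" "U \<in> addgroups A"
    using assms(4-6) by blast
  then show "summand x \<gamma> y t \<in> carrier (lin A)"
    using assms(1-3) by (simp add: A.emb_closed p_closed A.lin_mem G.lin_mem)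
qed

lemma lin_prod_alt:
  assumes c: "x \<in> carrier (lin A)" "\<gamma> \<in> carrier (lin G)" "y \<in> carrier (lin A)"
    and s: "I \<subseteq> addgroups A" "J \<subseteq> addgroups G" "K \<subseteq> addgroups A"
    and i: "lin_supp A x \<subseteq> I" "lin_supp G \<gamma> \<subseteq> J" "lin_supp A y \<subseteq> K"
    and f: "finite I" "finite J" "finite K"
  shows "lin_prod A G p x \<gamma> y = finprod (lin A) (summand x \<gamma> y) (I \<times> J \<times> K)"
  unfolding lin_prod_def
proof (rule L.finprod_mono_neutral_cong_left)
  show "summand x \<gamma> y t = \<one>\<^bsub>lin A\<^esub>"
    if ti: "t \<in> I \<times> J \<times> K - lin_supp A x \<times> lin_supp G \<gamma> \<times> lin_supp A y" for t
  proof -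
    obtain S T U where t: "t = (S, T, U)" "S \<in> addgroups A" "T \<in> addgroups G" "U \<in> addgroups A"
      using ti s by blast
    have "x S \<in> carrier A" "\<gamma> T \<in> carrier G" "y U \<in> carrier A"
      using A.lin_mem G.lin_mem c t by auto
    moreover have "x S = \<zero>\<^bsub>A\<^esub> \<or> \<gamma> T = \<zero>\<^bsub>G\<^esub> \<or> y U = \<zero>\<^bsub>A\<^esub>"
      using ti t by (auto simp: lin_supp_def)
    ultimately show ?thesis using t by (auto simp: p_zero A.emb_zero)
  qed
qed (use summand_closed[OF c s] i f in \<open>auto\<close>)

lemma fin_supp: "x \<in> carrier (lin A) \<Longrightarrow> finite (lin_supp A x)" "\<gamma> \<in> carrier (lin G) \<Longrightarrow> finite (lin_supp G \<gamma>)"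
  by (auto simp: A.carrier_lin G.carrier_lin)

lemma supp_sub: "lin_supp A x \<subseteq> addgroups A" "lin_supp G \<gamma> \<subseteq> addgroups G"
  by (auto simp: lin_supp_def)

lemma lin_prod_closed:
  assumes c: "x \<in> carrier (lin A)" "\<gamma> \<in> carrier (lin G)" "y \<in> carrier (lin A)"
  shows "lin_prod A G p x \<gamma> y \<in> carrier (lin A)"
  unfolding lin_prod_def by (rule L.finprod_closed) (rule summand_closed[OF c supp_sub(1) supp_sub(2) supp_sub(1)])

lemma addable_comp: 
  assumes "x \<in> carrier (lin A)" "x' \<in> carrier (lin A)" "S \<in> addgroups A" shows "x S \<sharp>\<^bsub>A\<^esub> x' S"
  using assms A.lin_mem A.addgroups_iff A.addible_pair by metis

lemma addable_compG: 
  assumes "x \<in> carrier (lin G)" "x' \<in> carrier (lin G)" "S \<in> addgroups G" shows "x S \<sharp>\<^bsub>G\<^esub> x' S"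
  using assms G.lin_mem G.addgroups_iff G.addible_pair by metis

lemma lin_prod_left:
  assumes c: "x \<in> carrier (lin A)" "x' \<in> carrier (lin A)" "\<gamma> \<in> carrier (lin G)" "y \<in> carrier (lin A)"
  shows "lin_prod A G p (x \<otimes>\<^bsub>lin A\<^esub> x') \<gamma> y = lin_prod A G p x \<gamma> y \<otimes>\<^bsub>lin A\<^esub> lin_prod A G p x' \<gamma> y"
proof -
  have c': "x \<otimes>\<^bsub>lin A\<^esub> x' \<in> carrier (lin A)" using c by simp
  let ?I = "lin_supp A x \<union> lin_supp A x' \<union> lin_supp A (x \<otimes>\<^bsub>lin A\<^esub> x')"
  let ?J = "lin_supp G \<gamma>" and ?K = "lin_supp A y"
  have s: "?I \<subseteq> addgroups A" "?J \<subseteq> addgroups G" "?K \<subseteq> addgroups A"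
    by (auto simp: lin_supp_def)
  have f: "finite ?I" "finite ?J" "finite ?K" using fin_supp c c' by blast+
  have "finprod (lin A) (summand (x \<otimes>\<^bsub>lin A\<^esub> x') \<gamma> y) (?I \<times> ?J \<times> ?K)
      = finprod (lin A) (\<lambda>t. summand x \<gamma> y t \<otimes>\<^bsub>lin A\<^esub> summand x' \<gamma> y t) (?I \<times> ?J \<times> ?K)"
  proof (rule L.finprod_cong'[OF refl])
    show "(\<lambda>t. summand x \<gamma> y t \<otimes>\<^bsub>lin A\<^esub> summand x' \<gamma> y t) \<in> ?I \<times> ?J \<times> ?K \<rightarrow> carrier (lin A)"
      by (intro Pi_I L.m_closed; rule funcset_mem[OF summand_closed[OF c(1,3,4) s]] funcset_mem[OF summand_closed[OF c(2,3,4) s]]; assumption)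
    fix t assume "t \<in> ?I \<times> ?J \<times> ?K"
    then obtain S T U where t: "t = (S, T, U)" "S \<in> addgroups A" "T \<in> addgroups G" "U \<in> addgroups A"
      using s by blast
    have q: "x S \<in> carrier A" "x' S \<in> carrier A" "\<gamma> T \<in> carrier G" "y U \<in> carrier A" "x S \<sharp>\<^bsub>A\<^esub> x' S"
      using A.lin_mem G.lin_mem c t addable_comp by auto
    show "summand (x \<otimes>\<^bsub>lin A\<^esub> x') \<gamma> y t = summand x \<gamma> y t \<otimes>\<^bsub>lin A\<^esub> summand x' \<gamma> y t"
      using t p_left[OF q] A.emb_add p_closed q by (simp add: A.mult_lin)
  qed
  also have "\<dots> = finprod (lin A) (summand x \<gamma> y) (?I \<times> ?J \<times> ?K) \<otimes>\<^bsub>lin A\<^esub> finprod (lin A) (summand x' \<gamma> y) (?I \<times> ?J \<times> ?K)"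
    by (rule L.finprod_multf[OF summand_closed[OF c(1,3,4) s] summand_closed[OF c(2,3,4) s]])
  finally show ?thesis
    using lin_prod_alt[OF c(1,3,4) s _ _ _ f] lin_prod_alt[OF c(2,3,4) s _ _ _ f] lin_prod_alt[OF c' c(3,4) s _ _ _ f]
    by (simp add: le_supI1 le_supI2)
qed

lemma lin_prod_right:
  assumes c: "x \<in> carrier (lin A)" "\<gamma> \<in> carrier (lin G)" "y \<in> carrier (lin A)" "y' \<in> carrier (lin A)"
  shows "lin_prod A G p x \<gamma> (y \<otimes>\<^bsub>lin A\<^esub> y') = lin_prod A G p x \<gamma> y \<otimes>\<^bsub>lin A\<^esub> lin_prod A G p x \<gamma> y'"
proof -
  have c': "y \<otimes>\<^bsub>lin A\<^esub> y' \<in> carrier (lin A)" using c by simp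
  let ?K = "lin_supp A y \<union> lin_supp A y' \<union> lin_supp A (y \<otimes>\<^bsub>lin A\<^esub> y')"
  let ?J = "lin_supp G \<gamma>" and ?I = "lin_supp A x"
  have s: "?I \<subseteq> addgroups A" "?J \<subseteq> addgroups G" "?K \<subseteq> addgroups A"
    by (auto simp: lin_supp_def)
  have f: "finite ?I" "finite ?J" "finite ?K" using fin_supp c c' by blast+
  have "finprod (lin A) (summand x \<gamma> (y \<otimes>\<^bsub>lin A\<^esub> y')) (?I \<times> ?J \<times> ?K)
      = finprod (lin A) (\<lambda>t. summand x \<gamma> y t \<otimes>\<^bsub>lin A\<^esub> summand x \<gamma> y' t) (?I \<times> ?J \<times> ?K)"
  proof (rule L.finprod_cong'[OF refl])
    show "(\<lambda>t. summand x \<gamma> y t \<otimes>\<^bsub>lin A\<^esub> summand x \<gamma> y' t) \<in> ?I \<times> ?J \<times> ?K \<rightarrow> carrier (lin A)"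
      by (intro Pi_I L.m_closed; rule funcset_mem[OF summand_closed[OF c(1,2,3) s]] funcset_mem[OF summand_closed[OF c(1,2,4) s]]; assumption)
    fix t assume "t \<in> ?I \<times> ?J \<times> ?K"
    then obtain S T U where t: "t = (S, T, U)" "S \<in> addgroups A" "T \<in> addgroups G" "U \<in> addgroups A"
      using s by blast
    have q: "x S \<in> carrier A" "\<gamma> T \<in> carrier G" "y U \<in> carrier A" "y' U \<in> carrier A" "y U \<sharp>\<^bsub>A\<^esub> y' U"
      using A.lin_mem G.lin_mem c t addable_comp by auto
    show "summand x \<gamma> (y \<otimes>\<^bsub>lin A\<^esub> y') t = summand x \<gamma> y t \<otimes>\<^bsub>lin A\<^esub> summand x \<gamma> y' t"
      using t p_right[OF q] A.emb_add p_closed q by (simp add: A.mult_lin)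
  qed
  also have "\<dots> = finprod (lin A) (summand x \<gamma> y) (?I \<times> ?J \<times> ?K) \<otimes>\<^bsub>lin A\<^esub> finprod (lin A) (summand x \<gamma> y') (?I \<times> ?J \<times> ?K)"
    by (rule L.finprod_multf[OF summand_closed[OF c(1,2,3) s] summand_closed[OF c(1,2,4) s]])
  finally show ?thesis
    using lin_prod_alt[OF c(1,2,3) s _ _ _ f] lin_prod_alt[OF c(1,2,4) s _ _ _ f] lin_prod_alt[OF c(1,2) c' s _ _ _ f]
    by (simp add: le_supI1 le_supI2)
qed

lemma lin_prod_middle:
  assumes c: "x \<in> carrier (lin A)" "\<gamma> \<in> carrier (lin G)" "\<gamma>' \<in> carrier (lin G)" "y \<in> carrier (lin A)"
  shows "lin_prod A G p x (\<gamma> \<otimes>\<^bsub>lin G\<^esub> \<gamma>') y = lin_prod A G p x \<gamma> y \<otimes>\<^bsub>lin A\<^esub> lin_prod A G p x \<gamma>' y"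
proof -
  have c': "\<gamma> \<otimes>\<^bsub>lin G\<^esub> \<gamma>' \<in> carrier (lin G)" using c by simp
  let ?J = "lin_supp G \<gamma> \<union> lin_supp G \<gamma>' \<union> lin_supp G (\<gamma> \<otimes>\<^bsub>lin G\<^esub> \<gamma>')"
  let ?K = "lin_supp A y" and ?I = "lin_supp A x"
  have s: "?I \<subseteq> addgroups A" "?J \<subseteq> addgroups G" "?K \<subseteq> addgroups A"
    by (auto simp: lin_supp_def)
  have f: "finite ?I" "finite ?J" "finite ?K" using fin_supp c c' by blast+
  have "finprod (lin A) (summand x (\<gamma> \<otimes>\<^bsub>lin G\<^esub> \<gamma>') y) (?I \<times> ?J \<times> ?K)
      = finprod (lin A) (\<lambda>t. summand x \<gamma> y t \<otimes>\<^bsub>lin A\<^esub> summand x \<gamma>' y t) (?I \<times> ?J \<times> ?K)"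
  proof (rule L.finprod_cong'[OF refl])
    show "(\<lambda>t. summand x \<gamma> y t \<otimes>\<^bsub>lin A\<^esub> summand x \<gamma>' y t) \<in> ?I \<times> ?J \<times> ?K \<rightarrow> carrier (lin A)"
      by (intro Pi_I L.m_closed; rule funcset_mem[OF summand_closed[OF c(1,2,4) s]] funcset_mem[OF summand_closed[OF c(1,3,4) s]]; assumption)
    fix t assume "t \<in> ?I \<times> ?J \<times> ?K"
    then obtain S T U where t: "t = (S, T, U)" "S \<in> addgroups A" "T \<in> addgroups G" "U \<in> addgroups A"
      using s by blast
    have q: "x S \<in> carrier A" "\<gamma> T \<in> carrier G" "\<gamma>' T \<in> carrier G" "y U \<in> carrier A" "\<gamma> T \<sharp>\<^bsub>G\<^esub> \<gamma>' T"
      using A.lin_mem G.lin_mem c t addable_compG by auto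
    show "summand x (\<gamma> \<otimes>\<^bsub>lin G\<^esub> \<gamma>') y t = summand x \<gamma> y t \<otimes>\<^bsub>lin A\<^esub> summand x \<gamma>' y t"
      using t p_middle[OF q] A.emb_add p_closed q by (simp add: G.mult_lin)
  qed
  also have "\<dots> = finprod (lin A) (summand x \<gamma> y) (?I \<times> ?J \<times> ?K) \<otimes>\<^bsub>lin A\<^esub> finprod (lin A) (summand x \<gamma>' y) (?I \<times> ?J \<times> ?K)"
    by (rule L.finprod_multf[OF summand_closed[OF c(1,2,4) s] summand_closed[OF c(1,3,4) s]])
  finally show ?thesis
    using lin_prod_alt[OF c(1,2,4) s _ _ _ f] lin_prod_alt[OF c(1,3,4) s _ _ _ f] lin_prod_alt[OF c(1) c' c(4) s _ _ _ f]
    by (simp add: le_supI1 le_supI2)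
qed

lemma lin_prod_emb:
  assumes c: "a \<in> carrier A" "\<gamma> \<in> carrier G" "b \<in> carrier A"
  shows "lin_prod A G p (emb A a) (emb G \<gamma>) (emb A b) = emb A (p a \<gamma> b)"
proof (cases "a = \<zero>\<^bsub>A\<^esub> \<or> \<gamma> = \<zero>\<^bsub>G\<^esub> \<or> b = \<zero>\<^bsub>A\<^esub>")
  case True
  then have "p a \<gamma> b = \<zero>\<^bsub>A\<^esub>" using c p_zero by auto
  with True show ?thesis
    using c by (auto simp: lin_prod_def A.lin_supp_emb G.lin_supp_emb A.emb_zero)
next
  case False
  then have "lin_supp A (emb A a) \<times> lin_supp G (emb G \<gamma>) \<times> lin_supp A (emb A b)
     = {(addible A a, addible G \<gamma>, addible A b)}"
    using c by (auto simp: A.lin_supp_emb G.lin_supp_emb)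
  then show ?thesis
    using c False by (simp add: lin_prod_def A.emb_addible G.emb_addible A.emb_closed p_closed Pi_def)
qed

lemma lin_prod_assoc:
  assumes c: "x \<in> carrier (lin A)" "\<gamma> \<in> carrier (lin G)" "y \<in> carrier (lin A)" "\<beta> \<in> carrier (lin G)"
    "z \<in> carrier (lin A)"
  shows "lin_prod A G p (lin_prod A G p x \<gamma> y) \<beta> z = lin_prod A G p x \<gamma> (lin_prod A G p y \<beta> z)"
  using c(1)
proof (induction rule: A.lin_induct)
  case (emb a)
  show ?case using c(2)
  proof (induction rule: G.lin_induct)
    case (emb g)
    show ?case using c(3)
    proof (induction rule: A.lin_induct)
      case (emb b)
      show ?case using c(4)
      proof (induction rule: G.lin_induct)
        case (emb h)
        show ?case using c(5)
        proof (induction rule: A.lin_induct)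
          case (emb d)
          then show ?case using \<open>a \<in> _\<close> \<open>b \<in> _\<close> \<open>g \<in> _\<close> \<open>h \<in> _\<close>
            by (simp add: lin_prod_emb p_closed p_assoc)
        qed (simp add: lin_prod_closed lin_prod_right A.emb_closed G.emb_closed \<open>a \<in> _\<close> \<open>b \<in> _\<close> \<open>g \<in> _\<close> \<open>h \<in> _\<close>)
      qed (simp add: lin_prod_closed lin_prod_right lin_prod_middle A.emb_closed G.emb_closed \<open>a \<in> _\<close> \<open>b \<in> _\<close> \<open>g \<in> _\<close> c)
    qed (simp add: lin_prod_closed lin_prod_left lin_prod_right A.emb_closed G.emb_closed \<open>a \<in> _\<close> \<open>g \<in> _\<close> c)
  qed (simp add: lin_prod_closed lin_prod_left lin_prod_middle A.emb_closed \<open>a \<in> _\<close> c)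
qed (simp add: lin_prod_closed lin_prod_left c)

lemma gamma_ring_lin: "gamma_ring (lin A) (lin G) (lin_prod A G p)"
  by unfold_locales
    (simp_all add: lin_prod_closed lin_prod_left lin_prod_middle lin_prod_right lin_prod_assoc)

end


section \<open>Independence of the radicals from the chosen types\<close>

text \<open>
  A (moduloid or \<open>\<Gamma>\<close>-)module is copied to the type \<open>'n\<close> along an injection \<open>g\<close> of its carrier with
  left inverse \<open>f\<close>. An irreducible moduloid consists of iterated sums of elements \<open>x \<gamma> c\<close> with
  fixed \<open>x\<close> and \<open>\<gamma>\<close>, and is therefore the image of the lists over \<open>A\<close>.
\<close>

context comm_homogroupoid begin

lemma addible_comm_group:
  assumes "a \<in> carrier H" "a \<noteq> \<zero>" shows "comm_group (grp_on H (addible H a))"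
  using assms addgroups_comm_group addgroups_iff by blast

lemma hneg_zero: "hneg H \<zero> = \<zero>"
  by (rule hneg_eqI) (simp_all add: zero_closed addable_zero add_zero)

lemma addable_hneg_hneg:
  assumes "x \<in> carrier H" "y \<in> carrier H" "x \<sharp> y" shows "hneg H x \<sharp> hneg H y"
  using assms addable_hneg[OF assms] addable_sym addable_hneg[of "hneg H y" x] hneg_props(1)
  by blast

lemma hneg_add:
  assumes s: "s \<in> carrier H" and w: "w \<in> carrier H" and sw: "s \<sharp> w"
  shows "hneg H (s \<boxplus> w) = hneg H s \<boxplus> hneg H w"
proof (cases "s = \<zero>")
  case True
  then show ?thesis using w by (simp add: zero_add hneg_zero hneg_props)
next
  case False
  interpret g: comm_group "grp_on H (addible H s)" by (rule addible_comm_group[OF s False])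
  have m: "s \<in> addible H s" "w \<in> addible H s" "hneg H s \<in> addible H s" "hneg H w \<in> addible H s"
    using assms by (auto simp: addible_def hneg_props addable_hneg addable_refl)
  have c: "s \<boxplus> w \<in> addible H s" "hneg H s \<boxplus> hneg H w \<in> addible H s"
    using m g.m_closed by auto
  show ?thesis
  proof (rule hneg_eqI)
    show "s \<boxplus> w \<sharp> hneg H s \<boxplus> hneg H w" using addible_pair[OF s False c] .
    have "(s \<boxplus> w) \<boxplus> (hneg H s \<boxplus> hneg H w) = (s \<boxplus> hneg H s) \<boxplus> (w \<boxplus> hneg H w)"
      using m g.m_ac g.m_closed by simp
    then show "s \<boxplus> w \<boxplus> (hneg H s \<boxplus> hneg H w) = \<zero>"
      using s w by (simp add: hneg_props add_zero zero_closed)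
  qed (use c addible_subset in auto)
qed

end

lemma not_singleton_mono: "\<lbrakk>S \<subseteq> T; S \<noteq> {z}; S \<noteq> {}\<rbrakk> \<Longrightarrow> T \<noteq> {z}"
  by blast

lemma not_singleton_ex: "\<lbrakk>S \<noteq> {}; S \<noteq> {z}\<rbrakk> \<Longrightarrow> \<exists>s\<in>S. s \<noteq> z"
  by auto

lemma image_singleton_iff:
  assumes "f ` g ` S = S" "f (g z) = z" shows "g ` S = {g z} \<longleftrightarrow> S = {z}"
proof
  assume "g ` S = {g z}"
  then have "f ` g ` S = f ` {g z}" by (rule arg_cong)
  then show "S = {z}" using assms by simp
qed simp

locale moduloid_copy = moduloid A G p M act
  for A :: "'a homogroupoid" and G :: "'g homogroupoid" and p
    and M :: "'m homogroupoid" and act +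
  fixes f :: "'n \<Rightarrow> 'm" and g :: "'m \<Rightarrow> 'n"
  assumes fg: "m \<in> carrier M \<Longrightarrow> f (g m) = m"
begin

definition M' :: "'n homogroupoid" where
  "M' = \<lparr>carrier = g ` carrier M, addable = (\<lambda>u v. f u \<sharp>\<^bsub>M\<^esub> f v),
     hadd = (\<lambda>u v. g (f u \<boxplus>\<^bsub>M\<^esub> f v)), hzero = g \<zero>\<^bsub>M\<^esub>\<rparr>"

definition act' :: "'n \<Rightarrow> 'g \<Rightarrow> 'a \<Rightarrow> 'n" where
  "act' u \<alpha> x = g (act (f u) \<alpha> x)"

lemma M'_simps [simp]:
  "carrier M' = g ` carrier M" "addable M' u v \<longleftrightarrow> f u \<sharp>\<^bsub>M\<^esub> f v"
  "hadd M' u v = g (f u \<boxplus>\<^bsub>M\<^esub> f v)" "hzero M' = g \<zero>\<^bsub>M\<^esub>"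
  by (simp_all add: M'_def)

lemma fg_image:
  assumes "S \<subseteq> carrier M" shows "f ` g ` S = S"
proof -
  have "(\<lambda>x. f (g x)) ` S = (\<lambda>x. x) ` S" using assms fg by (intro image_cong) blast+
  then show ?thesis by (simp add: image_image)
qed

lemma g_eq_iff: "\<lbrakk>m \<in> carrier M; n \<in> carrier M\<rbrakk> \<Longrightarrow> g m = g n \<longleftrightarrow> m = n"
  using fg by metis

lemma addible_M': "m \<in> carrier M \<Longrightarrow> addible M' (g m) = g ` addible M m"
  by (auto simp: addible_def fg)

lemma homogroupoid_M': "comm_homogroupoid M'"
proof (rule comm_homogroupoid.intro)
  show "group (grp_on M' (addible M' a))" if a: "a \<in> carrier M'" "a \<noteq> \<zero>\<^bsub>M'\<^esub>" for a
  proof -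
    obtain m where m: "m \<in> carrier M" "a = g m" "m \<noteq> \<zero>\<^bsub>M\<^esub>" using a by auto
    interpret gr: group "grp_on M (addible M m)" using m by (simp add: M.addible_group)
    note c = subsetD[OF M.addible_subset]
    note cl = gr.m_closed[simplified]
    have cl': "x \<boxplus>\<^bsub>M\<^esub> y \<in> carrier M" if "x \<in> addible M m" "y \<in> addible M m" for x y
      using cl[OF that] by (rule c)
    show ?thesis
    proof (rule groupI, goal_cases)
      case (1 x y)
      then show ?case using m cl by (auto simp: grp_on_def addible_M' fg c)
    next
      case 2
      then show ?case using m M.zero_in_addible by (auto simp: grp_on_def addible_M')
    next
      case (3 x y z)
      then show ?case using m gr.m_assoc[simplified] cl' by (auto simp: grp_on_def addible_M' fg c)
    next
      case (4 x)
      then show ?case using m by (auto simp: grp_on_def addible_M' fg c M.zero_closed M.zero_add)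
    next
      case (5 x)
      then obtain n where n: "n \<in> addible M m" "x = g n" using m by (auto simp: grp_on_def addible_M')
      obtain k where "k \<in> addible M m" "k \<boxplus>\<^bsub>M\<^esub> n = \<zero>\<^bsub>M\<^esub>"
        using gr.l_inv_ex[of n] n by auto
      then show ?case using n m by (intro bexI[of _ "g k"]) (auto simp: grp_on_def addible_M' fg c)
    qed
  qed
  show "addable M' x z" if "x \<in> carrier M'" "y \<in> carrier M'" "z \<in> carrier M'"
    "addable M' x y" "addable M' y z" "y \<noteq> \<zero>\<^bsub>M'\<^esub>" for x y z
  proof -
    have "f x \<in> carrier M" "f y \<in> carrier M" "f z \<in> carrier M" "f y \<noteq> \<zero>\<^bsub>M\<^esub>"
      using that by (auto simp: fg)
    then show ?thesis using that M.addable_trans[of "f x" "f y" "f z"] by simp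
  qed
next
  fix x y assume "x \<in> carrier M'" "y \<in> carrier M'" and xy: "addable M' x y"
  then have "f x \<in> carrier M" "f y \<in> carrier M" "f x \<sharp>\<^bsub>M\<^esub> f y" by (auto simp: fg)
  then show "addable M' y x" "hadd M' x y = hadd M' y x"
    using M.addable_sym[of "f x" "f y"] M.add_commute[of "f x" "f y"] by simp_all
qed (auto simp: fg M.add_closed M.zero_closed M.addable_zero M.add_zero M.addable_refl)

lemma moduloid_M': "moduloid A G p M' act'"
proof -
  interpret M': comm_homogroupoid M' by (rule homogroupoid_M')
  show ?thesis
    by unfold_locales
      (auto simp: act'_def fg act_closed act_right act_left act_assoc M.add_closed)
qed

lemma hneg_M':
  assumes m: "m \<in> carrier M" shows "hneg M' (g m) = g (hneg M m)"
proof -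
  interpret M': comm_homogroupoid M' by (rule homogroupoid_M')
  show ?thesis by (rule M'.hneg_eqI) (use M.hneg_props[OF m] m in \<open>auto simp: fg\<close>)
qed

lemma hminus_M':
  "\<lbrakk>m \<in> carrier M; n \<in> carrier M\<rbrakk> \<Longrightarrow> g m \<boxminus>\<^bsub>M'\<^esub> g n = g (m \<boxminus>\<^bsub>M\<^esub> n)"
  by (simp add: hminus_def hneg_M' fg M.hneg_props)

lemma submoduloid_M':
  assumes K: "submoduloid K A G M' act'"
  shows "submoduloid (f ` K) A G M act" and "K = g ` f ` K"
proof -
  have sub: "K \<subseteq> g ` carrier M" using K by (simp add: submoduloid_def)
  then have *: "f k \<in> carrier M \<and> g (f k) = k" if "k \<in> K" for k using that fg by auto
  then show "K = g ` f ` K" by (force simp: image_iff)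
  show "submoduloid (f ` K) A G M act"
    unfolding submoduloid_def
  proof (intro conjI ballI impI)
    show "f ` K \<noteq> {}" using K by (auto simp: submoduloid_def)
    show "f ` K \<subseteq> carrier M" using * by auto
  next
    fix x y assume "x \<in> f ` K" "y \<in> f ` K" and xy: "x \<sharp>\<^bsub>M\<^esub> y"
    then have x: "x \<in> carrier M" "g x \<in> K" and y: "y \<in> carrier M" "g y \<in> K" using * by auto
    have "g x \<boxminus>\<^bsub>M'\<^esub> g y \<in> K" using K x y xy by (auto simp: submoduloid_def fg)
    then have "f (g (x \<boxminus>\<^bsub>M\<^esub> y)) \<in> f ` K" using x y by (simp add: hminus_M')
    then show "x \<boxminus>\<^bsub>M\<^esub> y \<in> f ` K" using M.hminus_closed[OF x(1) y(1) xy] fg by simp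
  next
    fix x \<alpha> a assume "x \<in> f ` K" and a: "\<alpha> \<in> carrier G" "a \<in> carrier A"
    then have x: "x \<in> carrier M" "g x \<in> K" using * by auto
    have "act' (g x) \<alpha> a \<in> K" using K x a by (auto simp: submoduloid_def)
    then have "f (g (act x \<alpha> a)) \<in> f ` K" using x by (simp add: act'_def fg)
    then show "act x \<alpha> a \<in> f ` K" using act_closed[OF x(1) a] fg by simp
  qed
qed

lemma irreducible_M':
  assumes "irreducible_moduloid A G p M act"
  shows "irreducible_moduloid A G p M' act'"
  unfolding irreducible_moduloid_def
proof (intro conjI allI impI)
  show "moduloid A G p M' act'" by (rule moduloid_M')
  let ?S = "{act w \<alpha> a |w \<alpha> a. w \<in> carrier M \<and> \<alpha> \<in> carrier G \<and> a \<in> carrier A}"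
  let ?T = "{act' w \<alpha> a |w \<alpha> a. w \<in> carrier M' \<and> \<alpha> \<in> carrier G \<and> a \<in> carrier A}"
  have "?S \<subseteq> f ` ?T"
  proof
    fix s assume "s \<in> ?S"
    then obtain w \<alpha> a where w: "s = act w \<alpha> a" "w \<in> carrier M" "\<alpha> \<in> carrier G" "a \<in> carrier A" by auto
    have "act' (g w) \<alpha> a \<in> ?T" using w(2-4) by auto
    moreover have "s = f (act' (g w) \<alpha> a)" using w by (simp add: act'_def fg act_closed)
    ultimately show "s \<in> f ` ?T" by (rule rev_image_eqI)
  qed
  moreover have "?S \<noteq> {\<zero>\<^bsub>M\<^esub>}" using assms by (simp add: irreducible_moduloid_def)
  moreover have "?S \<noteq> {}" using M.zero_closed G.zero_closed A.zero_closed by auto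
  ultimately have nsub: "f ` ?T \<noteq> {\<zero>\<^bsub>M\<^esub>}" by (rule not_singleton_mono)
  show "?T \<noteq> {\<zero>\<^bsub>M'\<^esub>}"
  proof
    assume "?T = {\<zero>\<^bsub>M'\<^esub>}"
    then have "f ` ?T = f ` {\<zero>\<^bsub>M'\<^esub>}" by (rule arg_cong)
    also have "\<dots> = {\<zero>\<^bsub>M\<^esub>}" using fg[OF M.zero_closed] by simp
    finally show False using nsub by blast
  qed
  fix K assume K: "submoduloid K A G M' act'"
  have "f ` K = {\<zero>\<^bsub>M\<^esub>} \<or> f ` K = carrier M"
    using submoduloid_M'(1)[OF K] assms by (simp add: irreducible_moduloid_def)
  then show "K = {\<zero>\<^bsub>M'\<^esub>} \<or> K = carrier M'"
    using submoduloid_M'(2)[OF K] by auto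
qed

lemma regular_M':
  assumes "regular_moduloid A G M act" shows "regular_moduloid A G M' act'"
  unfolding regular_moduloid_def
proof (intro ballI impI)
  fix u \<alpha> \<beta> a b
  assume u: "u \<in> carrier M'" and c: "\<alpha> \<in> carrier G" "\<beta> \<in> carrier G" "a \<in> carrier A" "b \<in> carrier A"
    and h: "\<zero>\<^bsub>M'\<^esub> \<noteq> act' u \<alpha> a \<and> addable M' (act' u \<alpha> a) (act' u \<beta> b) \<and> act' u \<beta> b \<noteq> \<zero>\<^bsub>M'\<^esub>"
  obtain x where x: "x \<in> carrier M" "u = g x" using u by auto
  have "\<zero>\<^bsub>M\<^esub> \<noteq> act x \<alpha> a \<and> act x \<alpha> a \<sharp>\<^bsub>M\<^esub> act x \<beta> b \<and> act x \<beta> b \<noteq> \<zero>\<^bsub>M\<^esub>"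
    using h x c by (metis M'_simps(2,4) act'_def act_closed fg)
  then show "\<alpha> \<sharp>\<^bsub>G\<^esub> \<beta> \<and> a \<sharp>\<^bsub>A\<^esub> b"
    using assms x c unfolding regular_moduloid_def by blast
qed

lemma ann_M': "moduloid_ann A G M' act' = moduloid_ann A G M act"
proof -
  have "{act' w \<alpha> a |w \<alpha>. w \<in> carrier M' \<and> \<alpha> \<in> carrier G} = {\<zero>\<^bsub>M'\<^esub>} \<longleftrightarrow>
    {act w \<alpha> a |w \<alpha>. w \<in> carrier M \<and> \<alpha> \<in> carrier G} = {\<zero>\<^bsub>M\<^esub>}" (is "?T = _ \<longleftrightarrow> ?S = _")
    if a: "a \<in> carrier A" for a
  proof -
    have T: "?T = g ` ?S"
    proof (intro subset_antisym subsetI)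
      fix u assume "u \<in> ?T"
      then obtain m \<alpha> where "m \<in> carrier M" "\<alpha> \<in> carrier G" "u = act' (g m) \<alpha> a" by auto
      then show "u \<in> g ` ?S" by (auto simp: act'_def fg)
    next
      fix u assume "u \<in> g ` ?S"
      then obtain m \<alpha> where m: "m \<in> carrier M" "\<alpha> \<in> carrier G" "u = g (act m \<alpha> a)" by auto
      then have "u = act' (g m) \<alpha> a" by (simp add: act'_def fg)
      then show "u \<in> ?T" using m by auto
    qed
    have "f ` g ` ?S = ?S" by (rule fg_image) (use a act_closed in blast)
    from image_singleton_iff[OF this fg[OF M.zero_closed]]
    show ?thesis by (simp only: T M'_simps(4))
  qed
  then show ?thesis unfolding moduloid_ann_def by blast
qed

end

context moduloid begin

lemma act_zero:
  assumes "w \<in> carrier M" "\<alpha> \<in> carrier G" "x \<in> carrier A"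
  shows "act \<zero>\<^bsub>M\<^esub> \<alpha> x = \<zero>\<^bsub>M\<^esub>" and "act w \<alpha> \<zero>\<^bsub>A\<^esub> = \<zero>\<^bsub>M\<^esub>"
  using act_left[of "\<zero>\<^bsub>M\<^esub>" "\<zero>\<^bsub>M\<^esub>" \<alpha> x] act_right[of w \<alpha> "\<zero>\<^bsub>A\<^esub>" "\<zero>\<^bsub>A\<^esub>"]
    assms A.zero_closed M.zero_closed A.addable_zero M.addable_zero A.add_zero M.add_zero
    M.add_idem_zero act_closed
  by metis+

lemma irreducible_list_copy:
  assumes irr: "irreducible_moduloid A G p M act"
  shows "\<exists>f :: 'a list \<Rightarrow> 'm. carrier M \<subseteq> range f"
proof -
  let ?S = "{act w \<alpha> a |w \<alpha> a. w \<in> carrier M \<and> \<alpha> \<in> carrier G \<and> a \<in> carrier A}"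
  have "?S \<noteq> {}" using M.zero_closed G.zero_closed A.zero_closed by auto
  moreover have "?S \<noteq> {\<zero>\<^bsub>M\<^esub>}" using irr by (simp add: irreducible_moduloid_def)
  ultimately have "\<exists>s\<in>?S. s \<noteq> \<zero>\<^bsub>M\<^esub>" by (rule not_singleton_ex)
  then obtain x \<gamma> c0 where x: "x \<in> carrier M" "\<gamma> \<in> carrier G" "c0 \<in> carrier A"
      "act x \<gamma> c0 \<noteq> \<zero>\<^bsub>M\<^esub>" by blast
  define st where "st c w = (if act x \<gamma> c \<sharp>\<^bsub>M\<^esub> w then act x \<gamma> c \<boxplus>\<^bsub>M\<^esub> w else \<zero>\<^bsub>M\<^esub>)" for c w
  define ev where "ev cs = foldr st cs \<zero>\<^bsub>M\<^esub>" for cs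
  define R where "R = ev ` lists (carrier A)"
  have ev_Nil: "ev [] = \<zero>\<^bsub>M\<^esub>" and ev_Cons: "ev (c # cs) = st c (ev cs)" for c cs
    by (simp_all add: ev_def)
  have s_cl: "act x \<gamma> c \<in> carrier M" if "c \<in> carrier A" for c using act_closed x that by simp
  have ev_cl: "ev cs \<in> carrier M" if "cs \<in> lists (carrier A)" for cs
    using that by (induction cs) (auto simp: ev_Nil ev_Cons st_def M.zero_closed M.add_closed s_cl)
  have R0: "\<zero>\<^bsub>M\<^esub> \<in> R" unfolding R_def using ev_Nil by (metis image_eqI lists.Nil)
  have R_sub: "R \<subseteq> carrier M" using ev_cl by (auto simp: R_def)
  have step: "act x \<gamma> c \<boxplus>\<^bsub>M\<^esub> n \<in> R" if cn: "c \<in> carrier A" "n \<in> R" "act x \<gamma> c \<sharp>\<^bsub>M\<^esub> n" for c n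
  proof -
    obtain cs where "cs \<in> lists (carrier A)" "n = ev cs" using cn(2) by (auto simp: R_def)
    then have "act x \<gamma> c \<boxplus>\<^bsub>M\<^esub> n = ev (c # cs)" "c # cs \<in> lists (carrier A)"
      using cn by (auto simp: ev_Cons st_def)
    then show ?thesis unfolding R_def by blast
  qed
  have add: "n \<boxplus>\<^bsub>M\<^esub> ev cs \<in> R" if "cs \<in> lists (carrier A)" "n \<in> R" "n \<sharp>\<^bsub>M\<^esub> ev cs" for n cs
    using that
  proof (induction cs arbitrary: n rule: list.induct)
    case Nil
    then show ?case using R_sub by (auto simp: ev_Nil M.add_zero)
  next
    case (Cons c cs)
    let ?s = "act x \<gamma> c" and ?w = "ev cs"
    have c: "c \<in> carrier A" "cs \<in> lists (carrier A)" using Cons.prems by auto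
    have s: "?s \<in> carrier M" and w: "?w \<in> carrier M" and n: "n \<in> carrier M"
      using s_cl ev_cl c Cons.prems R_sub by auto
    show ?case
    proof (cases "?s \<sharp>\<^bsub>M\<^esub> ?w")
      case False
      then show ?thesis using Cons.prems n by (simp add: ev_Cons st_def M.add_zero)
    next
      case sw: True
      then have e: "ev (c # cs) = ?s \<boxplus>\<^bsub>M\<^esub> ?w" by (simp add: ev_Cons st_def)
      have nsw: "n \<sharp>\<^bsub>M\<^esub> ?s \<boxplus>\<^bsub>M\<^esub> ?w" using Cons.prems e by simp
      consider "?s = \<zero>\<^bsub>M\<^esub>" | "?w = \<zero>\<^bsub>M\<^esub>" | "?s \<boxplus>\<^bsub>M\<^esub> ?w = \<zero>\<^bsub>M\<^esub>"
        | "?s \<noteq> \<zero>\<^bsub>M\<^esub>" "?w \<noteq> \<zero>\<^bsub>M\<^esub>" "?s \<boxplus>\<^bsub>M\<^esub> ?w \<noteq> \<zero>\<^bsub>M\<^esub>" by blast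
      then show ?thesis
      proof cases
        case 1
        then have "ev (c # cs) = ?w" using e w by (simp add: M.zero_add)
        then show ?thesis using Cons.IH[OF c(2) Cons.prems(2)] Cons.prems(3) by simp
      next
        case 2
        then have es: "ev (c # cs) = ?s" using e s by (simp add: M.add_zero)
        then have ns: "n \<sharp>\<^bsub>M\<^esub> ?s" using Cons.prems by simp
        then show ?thesis
          using es step[OF c(1) Cons.prems(2)] M.addable_sym[OF n s ns] M.add_commute[OF n s ns] by simp
      next
        case 3
        then show ?thesis using e n Cons.prems by (simp add: M.add_zero)
      next
        case 4
        interpret g: comm_group "grp_on M (addible M ?s)" by (rule M.addible_comm_group[OF s 4(1)])
        have m: "?s \<in> addible M ?s" "?w \<in> addible M ?s"
          using s w sw by (auto simp: addible_def M.addable_refl)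
        then have sw_in: "?s \<boxplus>\<^bsub>M\<^esub> ?w \<in> addible M ?s" using g.m_closed by simp
        then have sws: "?s \<boxplus>\<^bsub>M\<^esub> ?w \<in> carrier M" "?s \<sharp>\<^bsub>M\<^esub> ?s \<boxplus>\<^bsub>M\<^esub> ?w" by (auto simp: addible_def)
        have "n \<sharp>\<^bsub>M\<^esub> ?s"
          using M.addable_trans[OF n sws(1) s nsw M.addable_sym[OF s sws] 4(3)] .
        then have mn: "n \<in> addible M ?s" using n s M.addable_sym by (simp add: addible_def)
        have "n \<sharp>\<^bsub>M\<^esub> ?w" using M.addible_pair[OF s 4(1) mn m(2)] .
        then have IH: "n \<boxplus>\<^bsub>M\<^esub> ?w \<in> R" using Cons.IH[OF c(2) Cons.prems(2)] by simp
        have "n \<boxplus>\<^bsub>M\<^esub> ?w \<in> addible M ?s" using g.m_closed mn m by simp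
        then have "?s \<sharp>\<^bsub>M\<^esub> n \<boxplus>\<^bsub>M\<^esub> ?w" by (simp add: addible_def)
        then have "?s \<boxplus>\<^bsub>M\<^esub> (n \<boxplus>\<^bsub>M\<^esub> ?w) \<in> R" using step[OF c(1) IH] by simp
        moreover have "?s \<boxplus>\<^bsub>M\<^esub> (n \<boxplus>\<^bsub>M\<^esub> ?w) = n \<boxplus>\<^bsub>M\<^esub> (?s \<boxplus>\<^bsub>M\<^esub> ?w)"
          using g.m_lcomm[of ?s n ?w] mn m by simp
        ultimately show ?thesis using e by simp
      qed
    qed
  qed
  have hom: "\<phi> n \<in> R" if n: "n \<in> R" and z: "\<phi> \<zero>\<^bsub>M\<^esub> = \<zero>\<^bsub>M\<^esub>"
    and ad: "\<And>u v. \<lbrakk>u \<in> carrier M; v \<in> carrier M; u \<sharp>\<^bsub>M\<^esub> v\<rbrakk> \<Longrightarrow> \<phi> u \<sharp>\<^bsub>M\<^esub> \<phi> v \<and> \<phi> (u \<boxplus>\<^bsub>M\<^esub> v) = \<phi> u \<boxplus>\<^bsub>M\<^esub> \<phi> v"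
    and sc: "\<And>c. c \<in> carrier A \<Longrightarrow> \<exists>d\<in>carrier A. \<phi> (act x \<gamma> c) = act x \<gamma> d" for \<phi> n
  proof -
    obtain cs where "cs \<in> lists (carrier A)" "n = ev cs" using n by (auto simp: R_def)
    moreover have "\<phi> (ev cs) \<in> R" if "cs \<in> lists (carrier A)" for cs
      using that
    proof (induction cs)
      case Nil
      then show ?case using R0 z by (simp add: ev_Nil)
    next
      case (Cons c cs)
      show ?case
      proof (cases "act x \<gamma> c \<sharp>\<^bsub>M\<^esub> ev cs")
        case False
        then show ?thesis using R0 z by (simp add: ev_Cons st_def)
      next
        case True
        obtain d where d: "d \<in> carrier A" "\<phi> (act x \<gamma> c) = act x \<gamma> d" using sc Cons by auto
        note a = ad[OF s_cl ev_cl True]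
        show ?thesis using True a step[OF d(1) Cons.IH] d Cons.hyps by (simp add: ev_Cons st_def)
      qed
    qed
    ultimately show ?thesis by simp
  qed
  have neg_s: "hneg M (act x \<gamma> c) = act x \<gamma> (hneg A c)" if c: "c \<in> carrier A" for c
    by (rule M.hneg_eqI)
      (use A.hneg_props[OF c] c x act_closed act_right[of x \<gamma> c "hneg A c"] act_zero in auto)
  have neg: "hneg M n \<in> R" if "n \<in> R" for n
    using that by (rule hom) (auto simp: M.hneg_zero M.addable_hneg_hneg M.hneg_add neg_s
        intro: bexI[OF _ A.hneg_props(1)])
  have "submoduloid R A G M act"
    unfolding submoduloid_def
  proof (intro conjI ballI impI)
    show "R \<noteq> {}" using R0 by auto
    show "R \<subseteq> carrier M" by (rule R_sub)
  next
    fix u v assume u: "u \<in> R" and v: "v \<in> R" and uv: "u \<sharp>\<^bsub>M\<^esub> v"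
    obtain cs where cs: "cs \<in> lists (carrier A)" "hneg M v = ev cs" using neg[OF v] by (auto simp: R_def)
    have "u \<sharp>\<^bsub>M\<^esub> ev cs" using M.addable_hneg[OF _ _ uv] u v R_sub cs by auto
    then show "u \<boxminus>\<^bsub>M\<^esub> v \<in> R" using add[OF cs(1) u] cs by (simp add: hminus_def)
  next
    fix u \<alpha> a assume u: "u \<in> R" and a: "\<alpha> \<in> carrier G" "a \<in> carrier A"
    show "act u \<alpha> a \<in> R"
      using u by (rule hom[of u "\<lambda>u. act u \<alpha> a"])
        (use a x act_left act_zero M.zero_closed in
          \<open>auto simp: act_assoc[symmetric] intro!: bexI[OF _ p_closed]\<close>)
  qed
  then have "R = {\<zero>\<^bsub>M\<^esub>} \<or> R = carrier M" using irr by (simp add: irreducible_moduloid_def)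
  moreover have "act x \<gamma> c0 \<in> R"
    using step[OF x(3) R0] s_cl[OF x(3)] by (simp add: M.addable_zero M.add_zero)
  ultimately have "R = carrier M" using x(4) by auto
  then show ?thesis unfolding R_def by (intro exI[of _ ev]) blast
qed

end

lemma moduloid_list_copy:
  fixes A :: "'a homogroupoid" and M :: "'m homogroupoid"
  assumes "irreducible_moduloid A G p M act"
  obtains M1 :: "'a list homogroupoid" and act1 where
    "irreducible_moduloid A G p M1 act1"
    "regular_moduloid A G M act \<Longrightarrow> regular_moduloid A G M1 act1"
    "moduloid_ann A G M1 act1 = moduloid_ann A G M act"
proof -
  interpret moduloid A G p M act using assms by (simp add: irreducible_moduloid_def)
  obtain f :: "'a list \<Rightarrow> 'm" where f: "carrier M \<subseteq> range f" using irreducible_list_copy[OF assms] by auto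
  interpret moduloid_copy A G p M act f "inv_into UNIV f"
    by unfold_locales (use f in \<open>auto simp: f_inv_into_f\<close>)
  show ?thesis using that irreducible_M'[OF assms] regular_M' ann_M' by blast
qed

lemma large_jacobson_radical_any_type:
  fixes M :: "'m homogroupoid"
  assumes "a \<in> large_jacobson_radical A G p" "irreducible_moduloid A G p M act"
  shows "a \<in> moduloid_ann A G M act"
  using assms(1) moduloid_list_copy[OF assms(2)] unfolding large_jacobson_radical_def by blast

lemma jacobson_radical_any_type:
  fixes M :: "'m homogroupoid"
  assumes "a \<in> jacobson_radical A G p" "irreducible_moduloid A G p M act" "regular_moduloid A G M act"
  shows "a \<in> moduloid_ann A G M act"
  using assms(1,3) moduloid_list_copy[OF assms(2)] unfolding jacobson_radical_def by blast

locale gamma_module_copy = gamma_module R \<Gamma> q V act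
  for R :: "'r monoid" and \<Gamma> :: "'c monoid" and q and V :: "'v monoid" and act +
  fixes f :: "'n \<Rightarrow> 'v" and g :: "'v \<Rightarrow> 'n"
  assumes fg: "v \<in> carrier V \<Longrightarrow> f (g v) = v"
begin

definition V' :: "'n monoid" where
  "V' = \<lparr>carrier = g ` carrier V, mult = (\<lambda>u v. g (f u \<otimes>\<^bsub>V\<^esub> f v)), one = g \<one>\<^bsub>V\<^esub>\<rparr>"

definition act' :: "'n \<Rightarrow> 'c \<Rightarrow> 'r \<Rightarrow> 'n" where
  "act' u \<alpha> x = g (act (f u) \<alpha> x)"

lemma V'_simps [simp]:
  "carrier V' = g ` carrier V" "mult V' u v = g (f u \<otimes>\<^bsub>V\<^esub> f v)" "one V' = g \<one>\<^bsub>V\<^esub>"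
  by (simp_all add: V'_def)

lemma fg_image:
  assumes "S \<subseteq> carrier V" shows "f ` g ` S = S"
proof -
  have "(\<lambda>x. f (g x)) ` S = (\<lambda>x. x) ` S" using assms fg by (intro image_cong) blast+
  then show ?thesis by (simp add: image_image)
qed

lemma comm_group_V': "comm_group V'"
proof (rule comm_groupI)
  fix x assume "x \<in> carrier V'"
  then obtain v where v: "v \<in> carrier V" "x = g v" by auto
  then show "\<exists>y\<in>carrier V'. y \<otimes>\<^bsub>V'\<^esub> x = \<one>\<^bsub>V'\<^esub>"
    by (intro bexI[of _ "g (inv\<^bsub>V\<^esub> v)"]) (auto simp: fg)
qed (auto simp: fg V.m_ac)

lemma module_V': "gamma_module R \<Gamma> q V' act'"
proof -
  interpret V': comm_group V' by (rule comm_group_V')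
  show ?thesis
    by unfold_locales
      (auto simp: act'_def fg act_closed act_right act_left act_middle act_assoc)
qed

lemma inv_V': "v \<in> carrier V \<Longrightarrow> inv\<^bsub>V'\<^esub> (g v) = g (inv\<^bsub>V\<^esub> v)"
proof -
  assume v: "v \<in> carrier V"
  interpret V': comm_group V' by (rule comm_group_V')
  show ?thesis by (rule V'.inv_equality) (use v in \<open>auto simp: fg\<close>)
qed

lemma submodule_V':
  assumes K: "gamma_submodule K R \<Gamma> V' act'"
  shows "gamma_submodule (f ` K) R \<Gamma> V act" and "K = g ` f ` K"
proof -
  interpret K: subgroup K V' using K by (simp add: gamma_submodule_def)
  have sub: "K \<subseteq> g ` carrier V" using K.subset by simp
  then have *: "f k \<in> carrier V \<and> g (f k) = k" if "k \<in> K" for k using that fg by auto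
  then show "K = g ` f ` K" by (force simp: image_iff)
  have K_im: "x \<in> carrier V" "g x \<in> K" if x: "x \<in> f ` K" for x
  proof -
    obtain k where "k \<in> K" "x = f k" using x by blast
    then show "x \<in> carrier V" "g x \<in> K" using *[of k] by simp_all
  qed
  have "subgroup (f ` K) V"
  proof
    show "f ` K \<subseteq> carrier V" using K_im by blast
    show "\<one>\<^bsub>V\<^esub> \<in> f ` K" using K.one_closed fg[of "\<one>\<^bsub>V\<^esub>"] by (metis V'_simps(3) V.one_closed imageI)
  next
    fix x y assume "x \<in> f ` K" "y \<in> f ` K"
    then have x: "x \<in> carrier V" "g x \<in> K" and y: "y \<in> carrier V" "g y \<in> K" using K_im by blast+
    have "g (x \<otimes>\<^bsub>V\<^esub> y) \<in> K" using K.m_closed[OF x(2) y(2)] x y by (simp add: fg)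
    moreover have "x \<otimes>\<^bsub>V\<^esub> y = f (g (x \<otimes>\<^bsub>V\<^esub> y))" using x y fg by simp
    ultimately show "x \<otimes>\<^bsub>V\<^esub> y \<in> f ` K" by (rule rev_image_eqI)
  next
    fix x assume "x \<in> f ` K"
    then have x: "x \<in> carrier V" "g x \<in> K" using K_im by blast+
    have "f (g (inv\<^bsub>V\<^esub> x)) \<in> f ` K" using K.m_inv_closed[OF x(2)] x by (simp add: inv_V')
    then show "inv\<^bsub>V\<^esub> x \<in> f ` K" using x fg by simp
  qed
  moreover have "act x \<alpha> a \<in> f ` K" if "x \<in> f ` K" and a: "\<alpha> \<in> carrier \<Gamma>" "a \<in> carrier R" for x \<alpha> a
  proof -
    have x: "x \<in> carrier V" "g x \<in> K" using K_im that by blast+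
    have "act' (g x) \<alpha> a \<in> K" using K x a by (auto simp: gamma_submodule_def)
    then have "f (g (act x \<alpha> a)) \<in> f ` K" using x by (simp add: act'_def fg)
    then show ?thesis using act_closed[OF x(1) a] fg by simp
  qed
  ultimately show "gamma_submodule (f ` K) R \<Gamma> V act" by (simp add: gamma_submodule_def)
qed

lemma irreducible_V':
  assumes "irreducible_gamma_module R \<Gamma> q V act"
  shows "irreducible_gamma_module R \<Gamma> q V' act'"
  unfolding irreducible_gamma_module_def
proof (intro conjI allI impI)
  show "gamma_module R \<Gamma> q V' act'" by (rule module_V')
  let ?S = "{act w \<alpha> a |w \<alpha> a. w \<in> carrier V \<and> \<alpha> \<in> carrier \<Gamma> \<and> a \<in> carrier R}"
  let ?T = "{act' w \<alpha> a |w \<alpha> a. w \<in> carrier V' \<and> \<alpha> \<in> carrier \<Gamma> \<and> a \<in> carrier R}"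
  have "?S \<subseteq> f ` ?T"
  proof
    fix s assume "s \<in> ?S"
    then obtain w \<alpha> a where w: "s = act w \<alpha> a" "w \<in> carrier V" "\<alpha> \<in> carrier \<Gamma>" "a \<in> carrier R" by auto
    have "act' (g w) \<alpha> a \<in> ?T" using w(2-4) by auto
    moreover have "s = f (act' (g w) \<alpha> a)" using w by (simp add: act'_def fg act_closed)
    ultimately show "s \<in> f ` ?T" by (rule rev_image_eqI)
  qed
  moreover have "?S \<noteq> {\<one>\<^bsub>V\<^esub>}" using assms by (simp add: irreducible_gamma_module_def)
  moreover have "?S \<noteq> {}" using V.one_closed \<Gamma>.one_closed R.one_closed by blast
  ultimately have nsub: "f ` ?T \<noteq> {\<one>\<^bsub>V\<^esub>}" by (rule not_singleton_mono)
  show "?T \<noteq> {\<one>\<^bsub>V'\<^esub>}"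
  proof
    assume "?T = {\<one>\<^bsub>V'\<^esub>}"
    then have "f ` ?T = f ` {\<one>\<^bsub>V'\<^esub>}" by (rule arg_cong)
    also have "\<dots> = {\<one>\<^bsub>V\<^esub>}" using fg[OF V.one_closed] by simp
    finally show False using nsub by blast
  qed
  fix K assume K: "gamma_submodule K R \<Gamma> V' act'"
  have "f ` K = {\<one>\<^bsub>V\<^esub>} \<or> f ` K = carrier V"
    using submodule_V'(1)[OF K] assms by (simp add: irreducible_gamma_module_def)
  then show "K = {\<one>\<^bsub>V'\<^esub>} \<or> K = carrier V'"
    using submodule_V'(2)[OF K] by auto
qed

lemma ann_V': "gamma_module_ann R \<Gamma> V' act' = gamma_module_ann R \<Gamma> V act"
proof -
  have "{act' w \<alpha> a |w \<alpha>. w \<in> carrier V' \<and> \<alpha> \<in> carrier \<Gamma>} = {\<one>\<^bsub>V'\<^esub>} \<longleftrightarrow>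
    {act w \<alpha> a |w \<alpha>. w \<in> carrier V \<and> \<alpha> \<in> carrier \<Gamma>} = {\<one>\<^bsub>V\<^esub>}" (is "?T = _ \<longleftrightarrow> ?S = _")
    if a: "a \<in> carrier R" for a
  proof -
    have T: "?T = g ` ?S"
    proof (intro subset_antisym subsetI)
      fix u assume "u \<in> ?T"
      then obtain m \<alpha> where "m \<in> carrier V" "\<alpha> \<in> carrier \<Gamma>" "u = act' (g m) \<alpha> a" by auto
      then show "u \<in> g ` ?S" by (auto simp: act'_def fg)
    next
      fix u assume "u \<in> g ` ?S"
      then obtain m \<alpha> where m: "m \<in> carrier V" "\<alpha> \<in> carrier \<Gamma>" "u = g (act m \<alpha> a)" by auto
      then have "u = act' (g m) \<alpha> a" by (simp add: act'_def fg)
      then show "u \<in> ?T" using m by auto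
    qed
    have "f ` g ` ?S = ?S" by (rule fg_image) (use a act_closed in blast)
    from image_singleton_iff[OF this fg[OF V.one_closed]]
    show ?thesis by (simp only: T V'_simps(3))
  qed
  then show ?thesis unfolding gamma_module_ann_def by blast
qed

end

lemma gamma_jacobson_radical_any_type:
  fixes R :: "'r monoid" and V :: "'v monoid"
  assumes a: "a \<in> gamma_jacobson_radical R \<Gamma> q" and irr: "irreducible_gamma_module R \<Gamma> q V act"
  shows "a \<in> gamma_module_ann R \<Gamma> V act"
proof -
  interpret gamma_module R \<Gamma> q V act using irr by (simp add: irreducible_gamma_module_def)
  let ?S = "{act w \<alpha> a |w \<alpha> a. w \<in> carrier V \<and> \<alpha> \<in> carrier \<Gamma> \<and> a \<in> carrier R}"
  have "?S \<noteq> {}" using V.one_closed \<Gamma>.one_closed R.one_closed by blast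
  moreover have "?S \<noteq> {\<one>\<^bsub>V\<^esub>}" using irr by (simp add: irreducible_gamma_module_def)
  ultimately have "\<exists>s\<in>?S. s \<noteq> \<one>\<^bsub>V\<^esub>" by (rule not_singleton_ex)
  then obtain v \<alpha> x where v: "v \<in> carrier V" "\<alpha> \<in> carrier \<Gamma>" "x \<in> carrier R"
      "act v \<alpha> x \<noteq> \<one>\<^bsub>V\<^esub>" by blast
  interpret h: group_hom R V "act v \<alpha>"
    by unfold_locales (use v act_closed act_right in \<open>auto simp: hom_def\<close>)
  have "gamma_submodule (act v \<alpha> ` carrier R) R \<Gamma> V act"
    unfolding gamma_submodule_def
    using h.img_is_subgroup v by (auto simp: act_assoc intro!: imageI q_closed)
  then have "act v \<alpha> ` carrier R = {\<one>\<^bsub>V\<^esub>} \<or> act v \<alpha> ` carrier R = carrier V"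
    using irr by (simp add: irreducible_gamma_module_def)
  then have surj: "act v \<alpha> ` carrier R = carrier V" using v by blast
  interpret gamma_module_copy R \<Gamma> q V act "act v \<alpha>" "inv_into (carrier R) (act v \<alpha>)"
    by unfold_locales (simp add: f_inv_into_f surj)
  show ?thesis
    using a irreducible_V'[OF irr] ann_V' unfolding gamma_jacobson_radical_def by blast
qed

end

theory Submission
  imports Defs
begin

text \<open>
  An irreducible module over the graded ring becomes an irreducible moduloid when all its elements
  are declared addable. Conversely, the linearization of an irreducible moduloid \<open>M\<close> is a module
  which every nonzero element of \<open>M\<close> generates. By Zorn's lemma it has a maximal submodule \<open>W\<close>,
  and \<open>W\<close> meets \<open>M\<close> only in \<open>\<zero>\<close>. An \<open>a\<close> in the radical of the ring annihilates the
  irreducible quotient by \<open>W\<close>, so \<open>MGa \<subseteq> M \<inter> W = {\<zero>}\<close>.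
\<close>


section \<open>Additive extension to the linearization\<close>

definition additive_map :: "'a homogroupoid \<Rightarrow> 'k monoid \<Rightarrow> ('a \<Rightarrow> 'k) \<Rightarrow> bool" where
  "additive_map H K \<phi> \<longleftrightarrow> \<phi> \<in> carrier H \<rightarrow> carrier K \<and>
     (\<forall>a\<in>carrier H. \<forall>b\<in>carrier H. a \<sharp>\<^bsub>H\<^esub> b \<longrightarrow> \<phi> (a \<boxplus>\<^bsub>H\<^esub> b) = \<phi> a \<otimes>\<^bsub>K\<^esub> \<phi> b)"

text \<open>The universal property of the direct sum: an \<open>additive_map\<close> is a
  homomorphism on each addibility group, and these glue to one homomorphism on \<open>lin H\<close>.
  Summing over the support keeps the product in \<open>K\<close> finite.\<close>

definition lin_ext :: "'a homogroupoid \<Rightarrow> 'k monoid \<Rightarrow> ('a \<Rightarrow> 'k) \<Rightarrow> ('a set \<Rightarrow> 'a) \<Rightarrow> 'k" where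
  "lin_ext H K \<phi> x = finprod K (\<lambda>S. \<phi> (x S)) (lin_supp H x)"

locale homogroupoid_to_group = comm_homogroupoid H + K: comm_group K
  for H :: "'a homogroupoid" (structure) and K :: "'k monoid"
begin

lemma additive_map_closed: "\<lbrakk>additive_map H K \<phi>; a \<in> carrier H\<rbrakk> \<Longrightarrow> \<phi> a \<in> carrier K"
  by (auto simp: additive_map_def)

lemma additive_map_add:
  "\<lbrakk>additive_map H K \<phi>; a \<in> carrier H; b \<in> carrier H; a \<sharp> b\<rbrakk> \<Longrightarrow> \<phi> (a \<boxplus> b) = \<phi> a \<otimes>\<^bsub>K\<^esub> \<phi> b"
  by (auto simp: additive_map_def)

lemma additive_map_zero:
  assumes "additive_map H K \<phi>" shows "\<phi> \<zero> = \<one>\<^bsub>K\<^esub>"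
proof -
  have "\<phi> \<zero> \<in> carrier K" using assms additive_map_closed zero_closed by blast
  moreover have "\<phi> \<zero> \<otimes>\<^bsub>K\<^esub> \<phi> \<zero> = \<phi> \<zero>"
    using additive_map_add[OF assms zero_closed zero_closed] zero_closed
    by (simp add: addable_zero add_zero)
  ultimately show ?thesis by simp
qed

lemma lin_mem_supp:
  "x \<in> carrier (lin H) \<Longrightarrow> S \<in> lin_supp H x \<Longrightarrow> x S \<in> carrier H"
  using lin_mem(2)[of x S] by (auto simp: lin_supp_def)

lemma lin_ext_closed:
  "\<lbrakk>additive_map H K \<phi>; x \<in> carrier (lin H)\<rbrakk> \<Longrightarrow> lin_ext H K \<phi> x \<in> carrier K"
  unfolding lin_ext_def by (rule K.finprod_closed) (auto intro: additive_map_closed lin_mem_supp)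

lemma lin_ext_emb:
  assumes "additive_map H K \<phi>" "a \<in> carrier H"
  shows "lin_ext H K \<phi> (emb H a) = \<phi> a"
  using assms additive_map_zero[OF assms(1)] additive_map_closed[OF assms]
  by (cases "a = \<zero>") (simp_all add: lin_ext_def lin_supp_emb emb_addible)

text \<open>Indices outside the support contribute \<open>\<phi> \<zero> = \<one>\<close>. This lets
  elements with different supports be summed over a common index set.\<close>

lemma lin_ext_superset:
  assumes "additive_map H K \<phi>" "x \<in> carrier (lin H)" "finite I" "lin_supp H x \<subseteq> I" "I \<subseteq> addgroups H"
  shows "lin_ext H K \<phi> x = finprod K (\<lambda>S. \<phi> (x S)) I"
  unfolding lin_ext_def
  by (rule K.finprod_mono_neutral_cong_left)
    (use assms in \<open>auto simp: lin_supp_def additive_map_zero intro: additive_map_closed lin_mem\<close>)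

lemma lin_ext_mult:
  assumes \<phi>: "additive_map H K \<phi>" and x: "x \<in> carrier (lin H)" and y: "y \<in> carrier (lin H)"
  shows "lin_ext H K \<phi> (x \<otimes>\<^bsub>lin H\<^esub> y) = lin_ext H K \<phi> x \<otimes>\<^bsub>K\<^esub> lin_ext H K \<phi> y"
proof -
  interpret L: comm_group "lin H" by (rule comm_group_lin)
  have xy: "x \<otimes>\<^bsub>lin H\<^esub> y \<in> carrier (lin H)" using x y by simp
  \<comment> \<open>The support of the product is included as well, so all three sums run over
    \<open>?I\<close> and no comparison of supports is required.\<close>
  let ?I = "lin_supp H x \<union> lin_supp H y \<union> lin_supp H (x \<otimes>\<^bsub>lin H\<^esub> y)"
  have I: "?I \<subseteq> addgroups H" by (auto simp: lin_supp_def)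
  have f: "finite ?I" using x y xy unfolding carrier_lin by blast
  have Pi: "(\<lambda>S. \<phi> (z S)) \<in> ?I \<rightarrow> carrier K" if "z \<in> carrier (lin H)" for z
    using that I by (intro Pi_I additive_map_closed[OF \<phi>] lin_mem) auto
  have "finprod K (\<lambda>S. \<phi> ((x \<otimes>\<^bsub>lin H\<^esub> y) S)) ?I = finprod K (\<lambda>S. \<phi> (x S) \<otimes>\<^bsub>K\<^esub> \<phi> (y S)) ?I"
  proof (rule K.finprod_cong'[OF refl])
    show "(\<lambda>S. \<phi> (x S) \<otimes>\<^bsub>K\<^esub> \<phi> (y S)) \<in> ?I \<rightarrow> carrier K"
      using Pi[OF x] Pi[OF y] by (auto simp: Pi_iff)
    fix S assume "S \<in> ?I"
    then have S: "S \<in> addgroups H" using I by blast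
    obtain a where a: "a \<in> carrier H" "a \<noteq> \<zero>" "S = addible H a" using S addgroups_iff by blast
    \<comment> \<open>Components at the same index lie in the addibility group of one nonzero
      element, hence are addable.\<close>
    have "x S \<sharp> y S" using addible_pair[OF a(1,2)] lin_mem(1)[OF x S] lin_mem(1)[OF y S] a(3) by blast
    then show "\<phi> ((x \<otimes>\<^bsub>lin H\<^esub> y) S) = \<phi> (x S) \<otimes>\<^bsub>K\<^esub> \<phi> (y S)"
      using additive_map_add[OF \<phi>] lin_mem(2)[OF x S] lin_mem(2)[OF y S] S by (simp add: mult_lin)
  qed
  also have "\<dots> = finprod K (\<lambda>S. \<phi> (x S)) ?I \<otimes>\<^bsub>K\<^esub> finprod K (\<lambda>S. \<phi> (y S)) ?I"
    by (rule K.finprod_multf[OF Pi[OF x] Pi[OF y]])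
  finally show ?thesis
    using lin_ext_superset[OF \<phi> x f _ I] lin_ext_superset[OF \<phi> y f _ I]
      lin_ext_superset[OF \<phi> xy f _ I] by (simp add: le_supI1 le_supI2)
qed

text \<open>Complements \<open>lin_ext_mult\<close>: here the map varies and the argument is fixed.
  In an iterated extension this yields additivity in the variables other than the one being
  extended.\<close>

lemma lin_ext_mult_fun:
  assumes "additive_map H K \<phi>" "additive_map H K \<psi>" and x: "x \<in> carrier (lin H)"
    and eq: "\<And>a. a \<in> carrier H \<Longrightarrow> \<chi> a = \<phi> a \<otimes>\<^bsub>K\<^esub> \<psi> a"
  shows "lin_ext H K \<chi> x = lin_ext H K \<phi> x \<otimes>\<^bsub>K\<^esub> lin_ext H K \<psi> x"
proof -
  have Pi: "(\<lambda>S. \<theta> (x S)) \<in> lin_supp H x \<rightarrow> carrier K" if "additive_map H K \<theta>" for \<theta>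
    using that x by (auto intro: additive_map_closed lin_mem_supp)
  have "lin_ext H K \<chi> x = finprod K (\<lambda>S. \<phi> (x S) \<otimes>\<^bsub>K\<^esub> \<psi> (x S)) (lin_supp H x)"
    unfolding lin_ext_def
    by (rule K.finprod_cong'[OF refl])
      (use assms Pi in \<open>auto simp: Pi_iff lin_mem_supp\<close>)
  then show ?thesis
    unfolding lin_ext_def using K.finprod_multf[OF Pi Pi] assms(1,2) by simp
qed

end

section \<open>Zero, negatives and differences under the embedding\<close>

context comm_homogroupoid
begin

lemma emb_eq_one_iff: "a \<in> carrier H \<Longrightarrow> emb H a = \<one>\<^bsub>lin H\<^esub> \<longleftrightarrow> a = \<zero>"
  using inj_on_eq_iff[OF inj_on_emb _ zero_closed] by (simp add: emb_zero)

lemma emb_hneg: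
  assumes "a \<in> carrier H" shows "emb H (hneg H a) = inv\<^bsub>lin H\<^esub> emb H a"
proof -
  interpret L: comm_group "lin H" by (rule comm_group_lin)
  have "emb H a \<otimes>\<^bsub>lin H\<^esub> emb H (hneg H a) = \<one>\<^bsub>lin H\<^esub>"
    using emb_add[of a "hneg H a"] hneg_props[OF assms] assms by (simp add: emb_zero)
  then show ?thesis
    using L.inv_equality[of "emb H (hneg H a)" "emb H a"] assms
    by (simp add: emb_closed hneg_props L.m_comm)
qed

lemma emb_hminus:
  assumes "a \<in> carrier H" "b \<in> carrier H" "a \<sharp> b"
  shows "emb H (a \<boxminus> b) = emb H a \<otimes>\<^bsub>lin H\<^esub> inv\<^bsub>lin H\<^esub> emb H b"
  using assms by (simp add: hminus_def emb_add addable_hneg hneg_props emb_hneg)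

end


section \<open>The linearization of an irreducible moduloid\<close>

context moduloid
begin

lemma act_hneg:
  assumes "w \<in> carrier M" "\<alpha> \<in> carrier G" "x \<in> carrier A"
  shows "act (hneg M w) \<alpha> x = hneg M (act w \<alpha> x)"
  by (rule M.hneg_eqI[symmetric])
    (use assms M.hneg_props[OF assms(1)] act_left[of w "hneg M w" \<alpha> x] act_zero(1) in
      \<open>auto intro: act_closed\<close>)

lemma act_hminus:
  assumes "w \<in> carrier M" "w' \<in> carrier M" "\<alpha> \<in> carrier G" "x \<in> carrier A" "w \<sharp>\<^bsub>M\<^esub> w'"
  shows "act (w \<boxminus>\<^bsub>M\<^esub> w') \<alpha> x = act w \<alpha> x \<boxminus>\<^bsub>M\<^esub> act w' \<alpha> x"
  using act_left[of w "hneg M w'" \<alpha> x] assms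
  by (simp add: hminus_def act_hneg M.hneg_props M.addable_hneg)

lemma submoduloid_eqI:
  assumes "irreducible_moduloid A G p M act" "submoduloid N A G M act" "m \<in> N" "m \<noteq> \<zero>\<^bsub>M\<^esub>"
  shows "N = carrier M"
  using assms unfolding irreducible_moduloid_def by blast

lemma irreducible_ex:
  assumes "irreducible_moduloid A G p M act"
  obtains w \<alpha> a where "w \<in> carrier M" "\<alpha> \<in> carrier G" "a \<in> carrier A" "act w \<alpha> a \<noteq> \<zero>\<^bsub>M\<^esub>"
proof -
  let ?S = "{act w \<alpha> a |w \<alpha> a. w \<in> carrier M \<and> \<alpha> \<in> carrier G \<and> a \<in> carrier A}"
  have "?S \<noteq> {}" using M.zero_closed G.zero_closed A.zero_closed by auto
  moreover have "?S \<noteq> {\<zero>\<^bsub>M\<^esub>}" using assms by (simp add: irreducible_moduloid_def)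
  ultimately have "\<exists>s\<in>?S. s \<noteq> \<zero>\<^bsub>M\<^esub>" by (rule not_singleton_ex)
  then show ?thesis using that by blast
qed

text \<open>
  Additivity in \<open>G\<close> holds on \<open>MGA\<close>, by associativity and additivity of the product of \<open>A\<close>. It is
  compared in \<^term>\<open>lin M\<close> since the elements of \<open>M\<close> with \<open>w\<alpha>x \<sharp> w\<beta>x\<close> for all \<open>\<alpha> \<sharp> \<beta>\<close> need not
  be closed under differences: addability is not transitive through \<open>\<zero>\<close>.
\<close>

lemma irreducible_emb_act_middle:
  assumes irr: "irreducible_moduloid A G p M act"
    and w: "w \<in> carrier M" and \<alpha>: "\<alpha> \<in> carrier G" "\<beta> \<in> carrier G" "\<alpha> \<sharp>\<^bsub>G\<^esub> \<beta>" and x: "x \<in> carrier A"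
  shows "emb M (act w (\<alpha> \<boxplus>\<^bsub>G\<^esub> \<beta>) x) = emb M (act w \<alpha> x) \<otimes>\<^bsub>lin M\<^esub> emb M (act w \<beta> x)"
proof -
  interpret L: comm_group "lin M" by (rule M.comm_group_lin)
  define P where "P w \<longleftrightarrow> (\<forall>\<alpha>\<in>carrier G. \<forall>\<beta>\<in>carrier G. \<forall>x\<in>carrier A. \<alpha> \<sharp>\<^bsub>G\<^esub> \<beta> \<longrightarrow>
    emb M (act w (\<alpha> \<boxplus>\<^bsub>G\<^esub> \<beta>) x) = emb M (act w \<alpha> x) \<otimes>\<^bsub>lin M\<^esub> emb M (act w \<beta> x))" for w
  define N where "N = {w \<in> carrier M. P w}"
  \<comment> \<open>All of \<open>MGA\<close> lies in \<open>N\<close>. This provides both the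
    closure of \<open>N\<close> under the action and a nonzero element of \<open>N\<close>.\<close>
  have act_N: "act w \<gamma> a \<in> N" if w: "w \<in> carrier M" "\<gamma> \<in> carrier G" "a \<in> carrier A" for w \<gamma> a
  proof -
    have "emb M (act (act w \<gamma> a) (\<alpha> \<boxplus>\<^bsub>G\<^esub> \<beta>) x) =
        emb M (act (act w \<gamma> a) \<alpha> x) \<otimes>\<^bsub>lin M\<^esub> emb M (act (act w \<gamma> a) \<beta> x)"
      if g: "\<alpha> \<in> carrier G" "\<beta> \<in> carrier G" "x \<in> carrier A" "\<alpha> \<sharp>\<^bsub>G\<^esub> \<beta>" for \<alpha> \<beta> x
    proof -
      have s: "\<alpha> \<boxplus>\<^bsub>G\<^esub> \<beta> \<in> carrier G" using g G.add_closed by blast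
      have pm: "p a \<alpha> x \<sharp>\<^bsub>A\<^esub> p a \<beta> x" "p a (\<alpha> \<boxplus>\<^bsub>G\<^esub> \<beta>) x = p a \<alpha> x \<boxplus>\<^bsub>A\<^esub> p a \<beta> x"
        using p_middle[OF w(3) g] by auto
      have pc: "p a \<alpha> x \<in> carrier A" "p a \<beta> x \<in> carrier A" using w g p_closed by auto
      have "act (act w \<gamma> a) (\<alpha> \<boxplus>\<^bsub>G\<^esub> \<beta>) x = act w \<gamma> (p a \<alpha> x \<boxplus>\<^bsub>A\<^esub> p a \<beta> x)"
        using act_assoc[OF w s g(3)] pm by simp
      then show ?thesis
        using act_right[OF w(1,2) pc pm(1)] w g pc
        by (simp add: M.emb_add act_closed act_assoc[symmetric])
    qed
    then show ?thesis using w act_closed by (auto simp: N_def P_def)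
  qed
  have "submoduloid N A G M act"
    unfolding submoduloid_def
  proof (intro conjI ballI impI)
    show "N \<noteq> {}" using act_N M.zero_closed G.zero_closed A.zero_closed by blast
    show "N \<subseteq> carrier M" by (auto simp: N_def)
  next
    fix u v assume uv: "u \<in> N" "v \<in> N" "u \<sharp>\<^bsub>M\<^esub> v"
    then have c: "u \<in> carrier M" "v \<in> carrier M" by (auto simp: N_def)
    \<comment> \<open>By \<open>act_left\<close> the two values at the same \<alpha> are addable, so
      \<open>emb\<close> turns their difference into a quotient in \<open>lin M\<close>. No
      addability between values at \<alpha> and at \<beta> is involved.\<close>
    have e: "emb M (act (u \<boxminus>\<^bsub>M\<^esub> v) \<alpha> x) =
        emb M (act u \<alpha> x) \<otimes>\<^bsub>lin M\<^esub> inv\<^bsub>lin M\<^esub> emb M (act v \<alpha> x)"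
      if "\<alpha> \<in> carrier G" "x \<in> carrier A" for \<alpha> x
      using c that uv(3) act_left[OF c that uv(3)]
      by (simp add: act_hminus M.emb_hminus act_closed)
    have "P (u \<boxminus>\<^bsub>M\<^esub> v)" unfolding P_def
    proof (intro ballI impI)
      fix \<alpha> \<beta> x assume g: "\<alpha> \<in> carrier G" "\<beta> \<in> carrier G" "x \<in> carrier A" "\<alpha> \<sharp>\<^bsub>G\<^esub> \<beta>"
      have "emb M (act n (\<alpha> \<boxplus>\<^bsub>G\<^esub> \<beta>) x) = emb M (act n \<alpha> x) \<otimes>\<^bsub>lin M\<^esub> emb M (act n \<beta> x)"
        if "n \<in> N" for n using that g by (auto simp: N_def P_def)
      from this[OF uv(1)] this[OF uv(2)]
      show "emb M (act (u \<boxminus>\<^bsub>M\<^esub> v) (\<alpha> \<boxplus>\<^bsub>G\<^esub> \<beta>) x) =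
          emb M (act (u \<boxminus>\<^bsub>M\<^esub> v) \<alpha> x) \<otimes>\<^bsub>lin M\<^esub> emb M (act (u \<boxminus>\<^bsub>M\<^esub> v) \<beta> x)"
        using g c by (simp add: e G.add_closed M.emb_closed act_closed L.inv_mult L.m_ac)
    qed
    then show "u \<boxminus>\<^bsub>M\<^esub> v \<in> N" using c uv(3) M.hminus_closed by (simp add: N_def)
  next
    fix u \<gamma> a assume "u \<in> N" "\<gamma> \<in> carrier G" "a \<in> carrier A"
    then show "act u \<gamma> a \<in> N" by (intro act_N) (auto simp: N_def)
  qed
  \<comment> \<open>The nonzero element \<open>act w0 \<gamma> a\<close> of \<open>N\<close> forces
    \<open>N\<close> to be all of \<open>M\<close>.\<close>
  moreover obtain w0 \<gamma> a where "w0 \<in> carrier M" "\<gamma> \<in> carrier G" "a \<in> carrier A" "act w0 \<gamma> a \<noteq> \<zero>\<^bsub>M\<^esub>"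
    using irreducible_ex[OF irr] .
  ultimately have "N = carrier M" using submoduloid_eqI[OF irr] act_N by blast
  then show ?thesis using w \<alpha> x by (auto simp: N_def P_def)
qed

end

text \<open>The moduloid axioms give additivity in \<open>M\<close> and in \<open>A\<close>; the
  extra assumption supplies it in \<open>G\<close>, so that the action extends triadditively.
  Irreducible moduloids satisfy it by \<open>irreducible_emb_act_middle\<close>.\<close>

locale lin_moduloid = moduloid A G p M act
  for A :: "'a homogroupoid" and G :: "'g homogroupoid" and p
    and M :: "'m homogroupoid" and act +
  assumes emb_act_middle: "\<lbrakk>w \<in> carrier M; \<alpha> \<in> carrier G; \<beta> \<in> carrier G; \<alpha> \<sharp>\<^bsub>G\<^esub> \<beta>; x \<in> carrier A\<rbrakk> \<Longrightarrow>
    emb M (act w (\<alpha> \<boxplus>\<^bsub>G\<^esub> \<beta>) x) = emb M (act w \<alpha> x) \<otimes>\<^bsub>lin M\<^esub> emb M (act w \<beta> x)"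
begin

interpretation LA: comm_group "lin A" by (rule A.comm_group_lin)
interpretation LG: comm_group "lin G" by (rule G.comm_group_lin)
interpretation LM: comm_group "lin M" by (rule M.comm_group_lin)
interpretation AM: homogroupoid_to_group A "lin M" ..
interpretation GM: homogroupoid_to_group G "lin M" ..
interpretation MM: homogroupoid_to_group M "lin M" ..

text \<open>The action is extended one variable at a time: \<open>act1\<close> in \<open>A\<close>,
  \<open>act2\<close> in \<open>G\<close>, \<open>lin_act\<close> in \<open>M\<close>. At each stage
  \<open>lin_ext_mult\<close> gives additivity in the new variable and
  \<open>lin_ext_mult_fun\<close> preserves it in the others.\<close>

definition act1 where "act1 m g x = lin_ext A (lin M) (\<lambda>b. emb M (act m g b)) x"
definition act2 where "act2 m \<gamma> x = lin_ext G (lin M) (\<lambda>g. act1 m g x) \<gamma>"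
definition lin_act where "lin_act v \<gamma> x = lin_ext M (lin M) (\<lambda>m. act2 m \<gamma> x) v"

lemma additive_act:
  "\<lbrakk>m \<in> carrier M; g \<in> carrier G\<rbrakk> \<Longrightarrow> additive_map A (lin M) (\<lambda>b. emb M (act m g b))"
  using act_right by (auto simp: additive_map_def M.emb_closed act_closed M.emb_add)

lemma act1_add:
  assumes x: "x \<in> carrier (lin A)"
  shows "\<lbrakk>m \<in> carrier M; n \<in> carrier M; m \<sharp>\<^bsub>M\<^esub> n; g \<in> carrier G\<rbrakk> \<Longrightarrow>
      act1 (m \<boxplus>\<^bsub>M\<^esub> n) g x = act1 m g x \<otimes>\<^bsub>lin M\<^esub> act1 n g x"
    and "\<lbrakk>m \<in> carrier M; g \<in> carrier G; h \<in> carrier G; g \<sharp>\<^bsub>G\<^esub> h\<rbrakk> \<Longrightarrow>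
      act1 m (g \<boxplus>\<^bsub>G\<^esub> h) x = act1 m g x \<otimes>\<^bsub>lin M\<^esub> act1 m h x"
  unfolding act1_def
   \<comment> \<open>The second statement, additivity in \<open>G\<close>, is where
     \<open>emb_act_middle\<close> enters.\<close>
   by (rule AM.lin_ext_mult_fun[OF additive_act additive_act x];
      use act_left in \<open>simp add: M.emb_add act_closed emb_act_middle\<close>)+

lemma additive_act1:
  "\<lbrakk>m \<in> carrier M; x \<in> carrier (lin A)\<rbrakk> \<Longrightarrow> additive_map G (lin M) (\<lambda>g. act1 m g x)"
  using AM.lin_ext_closed[OF additive_act]
  by (auto simp: additive_map_def act1_add) (simp add: act1_def)

lemma act2_add:
  assumes c: "\<gamma> \<in> carrier (lin G)"
  shows "\<lbrakk>m \<in> carrier M; n \<in> carrier M; m \<sharp>\<^bsub>M\<^esub> n; x \<in> carrier (lin A)\<rbrakk> \<Longrightarrow>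
      act2 (m \<boxplus>\<^bsub>M\<^esub> n) \<gamma> x = act2 m \<gamma> x \<otimes>\<^bsub>lin M\<^esub> act2 n \<gamma> x"
    and "\<lbrakk>m \<in> carrier M; x \<in> carrier (lin A); y \<in> carrier (lin A)\<rbrakk> \<Longrightarrow>
      act2 m \<gamma> (x \<otimes>\<^bsub>lin A\<^esub> y) = act2 m \<gamma> x \<otimes>\<^bsub>lin M\<^esub> act2 m \<gamma> y"
    and "\<lbrakk>m \<in> carrier M; x \<in> carrier (lin A); \<delta> \<in> carrier (lin G)\<rbrakk> \<Longrightarrow>
      act2 m (\<gamma> \<otimes>\<^bsub>lin G\<^esub> \<delta>) x = act2 m \<gamma> x \<otimes>\<^bsub>lin M\<^esub> act2 m \<delta> x"
  unfolding act2_def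
    apply (rule GM.lin_ext_mult_fun[OF additive_act1 additive_act1 c]; simp add: act1_add)
   apply (rule GM.lin_ext_mult_fun[OF additive_act1 additive_act1 c];
      simp add: act1_def AM.lin_ext_mult additive_act)
  by (simp add: GM.lin_ext_mult additive_act1 c)

lemma additive_act2:
  "\<lbrakk>\<gamma> \<in> carrier (lin G); x \<in> carrier (lin A)\<rbrakk> \<Longrightarrow> additive_map M (lin M) (\<lambda>m. act2 m \<gamma> x)"
  using GM.lin_ext_closed[OF additive_act1]
  by (auto simp: additive_map_def act2_add) (simp add: act2_def)

lemma lin_act_closed:
  "\<lbrakk>v \<in> carrier (lin M); \<gamma> \<in> carrier (lin G); x \<in> carrier (lin A)\<rbrakk> \<Longrightarrow> lin_act v \<gamma> x \<in> carrier (lin M)"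
  unfolding lin_act_def by (rule MM.lin_ext_closed[OF additive_act2])

lemma lin_act_left:
  "\<lbrakk>v \<in> carrier (lin M); w \<in> carrier (lin M); \<gamma> \<in> carrier (lin G); x \<in> carrier (lin A)\<rbrakk> \<Longrightarrow>
    lin_act (v \<otimes>\<^bsub>lin M\<^esub> w) \<gamma> x = lin_act v \<gamma> x \<otimes>\<^bsub>lin M\<^esub> lin_act w \<gamma> x"
  unfolding lin_act_def by (rule MM.lin_ext_mult[OF additive_act2])

lemma lin_act_middle:
  "\<lbrakk>v \<in> carrier (lin M); \<gamma> \<in> carrier (lin G); \<delta> \<in> carrier (lin G); x \<in> carrier (lin A)\<rbrakk> \<Longrightarrow>
    lin_act v (\<gamma> \<otimes>\<^bsub>lin G\<^esub> \<delta>) x = lin_act v \<gamma> x \<otimes>\<^bsub>lin M\<^esub> lin_act v \<delta> x"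
  unfolding lin_act_def
  by (rule MM.lin_ext_mult_fun[OF additive_act2 additive_act2]) (simp_all add: act2_add)

lemma lin_act_right:
  "\<lbrakk>v \<in> carrier (lin M); \<gamma> \<in> carrier (lin G); x \<in> carrier (lin A); y \<in> carrier (lin A)\<rbrakk> \<Longrightarrow>
    lin_act v \<gamma> (x \<otimes>\<^bsub>lin A\<^esub> y) = lin_act v \<gamma> x \<otimes>\<^bsub>lin M\<^esub> lin_act v \<gamma> y"
  unfolding lin_act_def
  by (rule MM.lin_ext_mult_fun[OF additive_act2 additive_act2]) (simp_all add: act2_add)

lemma lin_act_emb:
  "\<lbrakk>m \<in> carrier M; g \<in> carrier G; a \<in> carrier A\<rbrakk> \<Longrightarrow>
    lin_act (emb M m) (emb G g) (emb A a) = emb M (act m g a)"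
  using MM.lin_ext_emb[OF additive_act2, of "emb G g" "emb A a" m]
    GM.lin_ext_emb[OF additive_act1, of m "emb A a" g] AM.lin_ext_emb[OF additive_act, of m g a]
  by (simp add: lin_act_def act2_def act1_def A.emb_closed G.emb_closed)

text \<open>Both sides are additive in each of the five variables, so induction on every variable
  reduces the identity to embedded elements, where it is \<open>act_assoc\<close>.\<close>

lemma lin_act_assoc:
  assumes c: "v \<in> carrier (lin M)" "\<gamma> \<in> carrier (lin G)" "y \<in> carrier (lin A)" "\<beta> \<in> carrier (lin G)"
    "z \<in> carrier (lin A)"
  shows "lin_act (lin_act v \<gamma> y) \<beta> z = lin_act v \<gamma> (lin_prod A G p y \<beta> z)"
  using c(1)
proof (induction rule: M.lin_induct)
  case (emb m)
  show ?case using c(2)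
  proof (induction rule: G.lin_induct)
    case (emb g)
    show ?case using c(3)
    proof (induction rule: A.lin_induct)
      case (emb b)
      show ?case using c(4)
      proof (induction rule: G.lin_induct)
        case (emb h)
        show ?case using c(5)
        proof (induction rule: A.lin_induct)
          case (emb d)
          then show ?case using \<open>m \<in> _\<close> \<open>b \<in> _\<close> \<open>g \<in> _\<close> \<open>h \<in> _\<close>
            by (simp add: lin_prod_emb lin_act_emb act_closed p_closed act_assoc)
        qed (simp add: lin_act_closed lin_act_right lin_prod_closed lin_prod_right
            M.emb_closed A.emb_closed G.emb_closed \<open>m \<in> _\<close> \<open>b \<in> _\<close> \<open>g \<in> _\<close> \<open>h \<in> _\<close>)
      qed (simp add: lin_act_closed lin_act_right lin_act_middle lin_prod_closed lin_prod_middle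
          M.emb_closed A.emb_closed G.emb_closed \<open>m \<in> _\<close> \<open>b \<in> _\<close> \<open>g \<in> _\<close> c)
    qed (simp add: lin_act_closed lin_act_left lin_act_right lin_prod_closed lin_prod_left
        M.emb_closed G.emb_closed \<open>m \<in> _\<close> \<open>g \<in> _\<close> c)
  qed (simp add: lin_act_closed lin_act_left lin_act_middle lin_prod_closed M.emb_closed \<open>m \<in> _\<close> c)
qed (simp add: lin_act_closed lin_act_left lin_prod_closed c)

lemma gamma_module_lin: "gamma_module (lin A) (lin G) (lin_prod A G p) (lin M) lin_act"
proof -
  interpret gamma_ring "lin A" "lin G" "lin_prod A G p" by (rule gamma_ring_lin)
  show ?thesis
    by unfold_locales
      (simp_all add: lin_act_closed lin_act_left lin_act_middle lin_act_right lin_act_assoc)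
qed

text \<open>The trace of \<open>U\<close> on \<open>M\<close> is a submoduloid containing
  \<open>m\<close>, hence all of \<open>M\<close>, and the image of \<open>M\<close> generates
  \<open>lin M\<close> additively.\<close>

lemma gamma_submodule_lin_eqI:
  assumes irr: "irreducible_moduloid A G p M act"
    and U: "gamma_submodule U (lin A) (lin G) (lin M) lin_act"
    and m: "m \<in> carrier M" "emb M m \<in> U" "m \<noteq> \<zero>\<^bsub>M\<^esub>"
  shows "U = carrier (lin M)"
proof -
  interpret U: subgroup U "lin M" using U by (simp add: gamma_submodule_def)
  have U_act: "lin_act u \<gamma> x \<in> U" if "u \<in> U" "\<gamma> \<in> carrier (lin G)" "x \<in> carrier (lin A)" for u \<gamma> x
    using U that by (simp add: gamma_submodule_def)
  let ?N = "{m \<in> carrier M. emb M m \<in> U}"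
  have "submoduloid ?N A G M act"
    unfolding submoduloid_def
  proof (intro conjI ballI impI)
    show "?N \<noteq> {}" using m by blast
    show "x \<boxminus>\<^bsub>M\<^esub> y \<in> ?N" if "x \<in> ?N" "y \<in> ?N" "x \<sharp>\<^bsub>M\<^esub> y" for x y
      using that by (simp add: M.emb_hminus M.hminus_closed)
    show "act x \<alpha> a \<in> ?N" if "x \<in> ?N" "\<alpha> \<in> carrier G" "a \<in> carrier A" for x \<alpha> a
      using that U_act[of "emb M x" "emb G \<alpha>" "emb A a"]
      by (simp add: lin_act_emb act_closed G.emb_closed A.emb_closed)
  qed auto
  then have N: "?N = carrier M" using submoduloid_eqI[OF irr] m by blast
  have "v \<in> U" if "v \<in> carrier (lin M)" for v
    using that by (induction rule: M.lin_induct) (use N in auto)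
  then show ?thesis using U.subset by blast
qed

end


section \<open>Quotients of modules over a \<open>\<Gamma>\<close>-ring\<close>

locale gamma_module_quotient = gamma_module R \<Gamma> q V act
  for R :: "'r monoid" and \<Gamma> :: "'c monoid" and q and V :: "'v monoid" and act +
  fixes W :: "'v set"
  assumes submodule_W: "gamma_submodule W R \<Gamma> V act"
begin

lemma subgroup_W: "subgroup W V"
  using submodule_W by (simp add: gamma_submodule_def)

lemma normal_W: "W \<lhd> V"
  using subgroup_W by (rule V.subgroup_imp_normal)

interpretation W: normal W V by (rule normal_W)

text \<open>The union over all representatives avoids choosing one; for a coset \<open>X\<close> all
  members of the union coincide by \<open>quot_act_coset\<close>.\<close>

definition quot_act :: "'v set \<Rightarrow> 'c \<Rightarrow> 'r \<Rightarrow> 'v set" where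
  "quot_act X \<alpha> x = (\<Union>v\<in>X. W #>\<^bsub>V\<^esub> act v \<alpha> x)"

lemma coset_eq_one_iff: "v \<in> carrier V \<Longrightarrow> W #>\<^bsub>V\<^esub> v = W \<longleftrightarrow> v \<in> W"
  using V.coset_join1[OF _ _ subgroup_W] V.coset_join2[OF _ subgroup_W] by blast

text \<open>Independence of the representative: changing \<open>v\<close> by
  \<open>h \<in> W\<close> changes the value by \<open>act h \<alpha> x\<close>, which is again in
  \<open>W\<close>.\<close>

lemma quot_act_coset:
  assumes v: "v \<in> carrier V" "\<alpha> \<in> carrier \<Gamma>" "x \<in> carrier R"
  shows "quot_act (W #>\<^bsub>V\<^esub> v) \<alpha> x = W #>\<^bsub>V\<^esub> act v \<alpha> x"
proof -
  have "W #>\<^bsub>V\<^esub> act u \<alpha> x = W #>\<^bsub>V\<^esub> act v \<alpha> x" if u: "u \<in> W #>\<^bsub>V\<^esub> v" for u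
  proof -
    obtain h where h: "h \<in> W" "u = h \<otimes>\<^bsub>V\<^esub> v" using u by (auto simp: r_coset_def)
    have "act h \<alpha> x \<in> W" using submodule_W h v by (auto simp: gamma_submodule_def)
    then have "act u \<alpha> x \<in> W #>\<^bsub>V\<^esub> act v \<alpha> x"
      using h v W.subset by (auto simp: r_coset_def act_left)
    then show ?thesis
      using V.repr_independence[OF _ _ subgroup_W] act_closed[OF v] by blast
  qed
  moreover have "v \<in> W #>\<^bsub>V\<^esub> v" using V.rcos_self[OF v(1) subgroup_W] .
  ultimately show ?thesis unfolding quot_act_def by blast
qed

lemma gamma_module_quot: "gamma_module R \<Gamma> q (V Mod W) quot_act"
proof -
  interpret Q: comm_group "V Mod W" by (rule V.abelian_FactGroup[OF subgroup_W])
  show ?thesis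
    by unfold_locales
      (auto simp: carrier_FactGroup W.rcos_sum quot_act_coset act_closed act_left act_middle act_right
        act_assoc q_closed)
qed

text \<open>Submodules of the quotient correspond to submodules of \<open>V\<close> above
  \<open>W\<close>, of which there are at most two by \<open>max\<close>. The element
  \<open>act v \<alpha> x\<close> outside \<open>W\<close> makes the quotient action
  nonzero.\<close>

lemma irreducible_quot:
  assumes max: "\<And>U. \<lbrakk>gamma_submodule U R \<Gamma> V act; W \<subseteq> U\<rbrakk> \<Longrightarrow> U = W \<or> U = carrier V"
    and v: "v \<in> carrier V" "\<alpha> \<in> carrier \<Gamma>" "x \<in> carrier R" "act v \<alpha> x \<notin> W"
  shows "irreducible_gamma_module R \<Gamma> q (V Mod W) quot_act"
  unfolding irreducible_gamma_module_def
proof (intro conjI allI impI)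
  show "gamma_module R \<Gamma> q (V Mod W) quot_act" by (rule gamma_module_quot)
  have "quot_act (W #>\<^bsub>V\<^esub> v) \<alpha> x \<noteq> \<one>\<^bsub>V Mod W\<^esub>"
    using v act_closed by (simp add: quot_act_coset coset_eq_one_iff)
  moreover have "W #>\<^bsub>V\<^esub> v \<in> carrier (V Mod W)" using v by (simp add: carrier_FactGroup)
  ultimately show "{quot_act X \<alpha> x |X \<alpha> x. X \<in> carrier (V Mod W) \<and> \<alpha> \<in> carrier \<Gamma> \<and> x \<in> carrier R}
      \<noteq> {\<one>\<^bsub>V Mod W\<^esub>}"
    using v by blast
next
  fix U assume U: "gamma_submodule U R \<Gamma> (V Mod W) quot_act"
  interpret gm: gamma_module R \<Gamma> q "V Mod W" quot_act by (rule gamma_module_quot)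
  interpret U: subgroup U "V Mod W" using U by (simp add: gamma_submodule_def)
  interpret h: group_hom V "V Mod W" "\<lambda>v. W #>\<^bsub>V\<^esub> v"
    by unfold_locales (rule W.r_coset_hom_Mod)
  \<comment> \<open>The preimage of \<open>U\<close> under the projection.\<close>
  let ?P = "{v \<in> carrier V. W #>\<^bsub>V\<^esub> v \<in> U}"
  have "subgroup ?P V"
  proof (rule V.subgroupI)
    have "\<one>\<^bsub>V\<^esub> \<in> ?P" using V.one_closed U.one_closed h.hom_one by simp
    then show "?P \<noteq> {}" by blast
  next
    fix u v assume "u \<in> ?P" "v \<in> ?P"
    then have c: "u \<in> carrier V" "v \<in> carrier V" "W #>\<^bsub>V\<^esub> u \<in> U" "W #>\<^bsub>V\<^esub> v \<in> U" by auto
    have "W #>\<^bsub>V\<^esub> (u \<otimes>\<^bsub>V\<^esub> v) \<in> U"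
      unfolding h.hom_mult[OF c(1,2)] by (rule U.m_closed[OF c(3,4)])
    then show "u \<otimes>\<^bsub>V\<^esub> v \<in> ?P" using c(1,2) by blast
  next
    fix v assume "v \<in> ?P"
    then have v: "v \<in> carrier V" "W #>\<^bsub>V\<^esub> v \<in> U" by auto
    have "W #>\<^bsub>V\<^esub> inv\<^bsub>V\<^esub> v \<in> U"
      unfolding h.hom_inv[OF v(1)] by (rule U.m_inv_closed[OF v(2)])
    then show "inv\<^bsub>V\<^esub> v \<in> ?P" using v(1) by blast
  qed blast
  moreover have "act u \<alpha> x \<in> ?P" if u: "u \<in> ?P" "\<alpha> \<in> carrier \<Gamma>" "x \<in> carrier R" for u \<alpha> x
  proof -
    have "quot_act (W #>\<^bsub>V\<^esub> u) \<alpha> x \<in> U" using U u by (simp add: gamma_submodule_def)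
    then show ?thesis using u act_closed by (simp add: quot_act_coset)
  qed
  ultimately have "gamma_submodule ?P R \<Gamma> V act" by (simp add: gamma_submodule_def)
  moreover have "W \<subseteq> ?P"
    using W.subset U.one_closed by (auto simp: coset_eq_one_iff[THEN iffD2])
  ultimately consider "?P = W" | "?P = carrier V" using max by blast
  \<comment> \<open>If the preimage is \<open>W\<close>, then \<open>U\<close> contains only the
    neutral coset; if it is \<open>V\<close>, then \<open>U\<close> contains every coset.\<close>
  then show "U = {\<one>\<^bsub>V Mod W\<^esub>} \<or> U = carrier (V Mod W)"
  proof cases
    case 1
    then have "X = \<one>\<^bsub>V Mod W\<^esub>" if "X \<in> U" for X
      using U.subset that coset_eq_one_iff by (auto simp: carrier_FactGroup)
    then show ?thesis using U.one_closed by blast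
  next
    case 2
    then show ?thesis using U.subset by (auto simp: carrier_FactGroup)
  qed
qed

end


section \<open>Maximal submodules of the linearization\<close>

text \<open>Passes from pointwise vanishing of an action to the set equations defining annihilators.
  The witnesses \<open>x0\<close> and \<open>y0\<close> rule out the empty set.\<close>

lemma Collect_constant2:
  assumes "x0 \<in> X" "y0 \<in> Y" and eq: "\<And>x y. \<lbrakk>x \<in> X; y \<in> Y\<rbrakk> \<Longrightarrow> f x y = z"
  shows "{f x y |x y. x \<in> X \<and> y \<in> Y} = {z}"
proof -
  have "z = f x0 y0 \<and> x0 \<in> X \<and> y0 \<in> Y" using assms by simp
  then have "\<exists>x y. z = f x y \<and> x \<in> X \<and> y \<in> Y" by (intro exI)
  then show ?thesis using eq by auto
qed

lemma Collect_constant3: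
  assumes "u0 \<in> U" "x0 \<in> X" "y0 \<in> Y"
    and eq: "\<And>u x y. \<lbrakk>u \<in> U; x \<in> X; y \<in> Y\<rbrakk> \<Longrightarrow> f u x y = z"
  shows "{f u x y |u x y. u \<in> U \<and> x \<in> X \<and> y \<in> Y} = {z}"
proof -
  have "z = f u0 x0 y0 \<and> u0 \<in> U \<and> x0 \<in> X \<and> y0 \<in> Y" using assms by simp
  then have "\<exists>u x y. z = f u x y \<and> u \<in> U \<and> x \<in> X \<and> y \<in> Y" by (intro exI)
  then show ?thesis using eq by auto
qed

text \<open>Only closure under products involves two elements of the union, and the chain property
  places both in a single member.\<close>

lemma gamma_submodule_Union_chain:
  assumes gm: "gamma_module R \<Gamma> q V act"
    and ne: "\<C> \<noteq> {}" and chain: "\<And>X Y. \<lbrakk>X \<in> \<C>; Y \<in> \<C>\<rbrakk> \<Longrightarrow> X \<subseteq> Y \<or> Y \<subseteq> X"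
    and sub: "\<And>X. X \<in> \<C> \<Longrightarrow> gamma_submodule X R \<Gamma> V act"
  shows "gamma_submodule (\<Union>\<C>) R \<Gamma> V act"
proof -
  interpret gamma_module R \<Gamma> q V act by (rule gm)
  have sg: "subgroup X V" if "X \<in> \<C>" for X using sub[OF that] by (simp add: gamma_submodule_def)
  have "subgroup (\<Union>\<C>) V"
  proof (rule V.subgroupI)
    show "\<Union>\<C> \<subseteq> carrier V" using subgroup.subset[OF sg] by blast
    show "\<Union>\<C> \<noteq> {}" using ne subgroup.one_closed[OF sg] by blast
    show "inv\<^bsub>V\<^esub> a \<in> \<Union>\<C>" if "a \<in> \<Union>\<C>" for a
      using that subgroup.m_inv_closed[OF sg] by blast
  next
    fix a b assume "a \<in> \<Union>\<C>" "b \<in> \<Union>\<C>"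
    then obtain X where "X \<in> \<C>" "a \<in> X" "b \<in> X" using chain by blast
    then show "a \<otimes>\<^bsub>V\<^esub> b \<in> \<Union>\<C>" using subgroup.m_closed[OF sg] by blast
  qed
  moreover have "act u \<alpha> x \<in> \<Union>\<C>" if "u \<in> \<Union>\<C>" "\<alpha> \<in> carrier \<Gamma>" "x \<in> carrier R" for u \<alpha> x
    using that sub unfolding gamma_submodule_def by blast
  ultimately show ?thesis by (simp add: gamma_submodule_def)
qed

context lin_moduloid
begin

interpretation LM: comm_group "lin M" by (rule M.comm_group_lin)

text \<open>Zorn's lemma is applied to the submodules meeting \<open>M\<close> only in
  \<open>\<zero>\<close>, a condition inherited by unions of chains. For irreducible
  \<open>M\<close>, \<open>gamma_submodule_lin_eqI\<close> then makes every strictly larger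
  submodule the whole of \<open>lin M\<close>.\<close>

lemma ex_maximal_gamma_submodule:
  "\<exists>W. gamma_submodule W (lin A) (lin G) (lin M) lin_act \<and>
    (\<forall>m\<in>carrier M. emb M m \<in> W \<longrightarrow> m = \<zero>\<^bsub>M\<^esub>) \<and>
    (\<forall>U. gamma_submodule U (lin A) (lin G) (lin M) lin_act \<longrightarrow> W \<subset> U \<longrightarrow>
       (\<exists>m\<in>carrier M. emb M m \<in> U \<and> m \<noteq> \<zero>\<^bsub>M\<^esub>))"
proof -
  interpret V: gamma_module "lin A" "lin G" "lin_prod A G p" "lin M" lin_act
    by (rule gamma_module_lin)
  define \<W> where "\<W> = {W. gamma_submodule W (lin A) (lin G) (lin M) lin_act \<and>
    (\<forall>m\<in>carrier M. emb M m \<in> W \<longrightarrow> m = \<zero>\<^bsub>M\<^esub>)}"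
  have one: "lin_act \<one>\<^bsub>lin M\<^esub> \<gamma> x = \<one>\<^bsub>lin M\<^esub>"
    if "\<gamma> \<in> carrier (lin G)" "x \<in> carrier (lin A)" for \<gamma> x
    using V.act_left[of "\<one>\<^bsub>lin M\<^esub>" "\<one>\<^bsub>lin M\<^esub>" \<gamma> x] V.act_closed[of "\<one>\<^bsub>lin M\<^esub>" \<gamma> x] that
    by simp
  \<comment> \<open>The trivial submodule qualifies because \<open>emb M\<close> is
    injective.\<close>
  have "{\<one>\<^bsub>lin M\<^esub>} \<in> \<W>"
    by (auto simp: \<W>_def gamma_submodule_def LM.triv_subgroup one M.emb_eq_one_iff)
  then have "\<W> \<noteq> {}" by blast
  moreover have "\<Union>\<C> \<in> \<W>" if C: "\<C> \<noteq> {}" "subset.chain \<W> \<C>" for \<C>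
  proof -
    have "gamma_submodule (\<Union>\<C>) (lin A) (lin G) (lin M) lin_act"
      by (rule gamma_submodule_Union_chain[OF gamma_module_lin C(1)])
        (use C(2) in \<open>auto simp: subset_chain_def \<W>_def\<close>)
    then show ?thesis using C(2) by (auto simp: subset_chain_def \<W>_def)
  qed
  ultimately have "\<exists>W\<in>\<W>. \<forall>X\<in>\<W>. W \<subseteq> X \<longrightarrow> X = W" by (rule subset_Zorn_nonempty)
  then obtain W where W: "W \<in> \<W>" "\<And>X. \<lbrakk>X \<in> \<W>; W \<subseteq> X\<rbrakk> \<Longrightarrow> X = W" by blast
  show ?thesis by (rule exI[of _ W]) (use W in \<open>auto simp: \<W>_def\<close>)
qed

lemma gamma_jacobson_radical_ann:
  assumes irr: "irreducible_moduloid A G p M act" and a: "a \<in> carrier A"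
    and J: "emb A a \<in> gamma_jacobson_radical (lin A) (lin G) (lin_prod A G p)"
  shows "a \<in> moduloid_ann A G M act"
proof -
  obtain W where W: "gamma_submodule W (lin A) (lin G) (lin M) lin_act"
    and W_emb: "\<And>m. \<lbrakk>m \<in> carrier M; emb M m \<in> W\<rbrakk> \<Longrightarrow> m = \<zero>\<^bsub>M\<^esub>"
    and W_max: "\<And>U. \<lbrakk>gamma_submodule U (lin A) (lin G) (lin M) lin_act; W \<subset> U\<rbrakk> \<Longrightarrow>
       \<exists>m\<in>carrier M. emb M m \<in> U \<and> m \<noteq> \<zero>\<^bsub>M\<^esub>"
    using ex_maximal_gamma_submodule by metis
  interpret Q: gamma_module_quotient "lin A" "lin G" "lin_prod A G p" "lin M" lin_act W
    by (intro gamma_module_quotient.intro gamma_module_quotient_axioms.intro gamma_module_lin W)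
  obtain w \<alpha> b where w: "w \<in> carrier M" "\<alpha> \<in> carrier G" "b \<in> carrier A" "act w \<alpha> b \<noteq> \<zero>\<^bsub>M\<^esub>"
    using irreducible_ex[OF irr] .
  have "irreducible_gamma_module (lin A) (lin G) (lin_prod A G p) (lin M Mod W) Q.quot_act"
  proof (rule Q.irreducible_quot)
    show "lin_act (emb M w) (emb G \<alpha>) (emb A b) \<notin> W"
      using w W_emb[of "act w \<alpha> b"] by (auto simp: lin_act_emb act_closed)
    \<comment> \<open>A \<open>U\<close> strictly above \<open>W\<close> contains a nonzero element
      of \<open>M\<close>, which generates everything.\<close>
    show "U = W \<or> U = carrier (lin M)"
      if U: "gamma_submodule U (lin A) (lin G) (lin M) lin_act" "W \<subseteq> U" for U
      using W_max[of U] gamma_submodule_lin_eqI[OF irr U(1)] U by blast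
  qed (use w in \<open>simp_all add: M.emb_closed G.emb_closed A.emb_closed\<close>)
  \<comment> \<open>The elements of the quotient are cosets in \<open>lin M\<close>, not elements of
    the type of \<open>lin A\<close> over which the radical is defined, hence the version for
    arbitrary types.\<close>
  from gamma_jacobson_radical_any_type[OF J this]
  have ann: "{Q.quot_act X \<gamma> (emb A a) |X \<gamma>. X \<in> carrier (lin M Mod W) \<and> \<gamma> \<in> carrier (lin G)} =
      {\<one>\<^bsub>lin M Mod W\<^esub>}"
    by (simp add: gamma_module_ann_def)
  have "act m \<gamma> a = \<zero>\<^bsub>M\<^esub>" if m: "m \<in> carrier M" "\<gamma> \<in> carrier G" for m \<gamma>
  proof -
    have c: "emb M m \<in> carrier (lin M)" "emb G \<gamma> \<in> carrier (lin G)" "emb A a \<in> carrier (lin A)"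
      using m a by (simp_all add: M.emb_closed G.emb_closed A.emb_closed)
    then have "W #>\<^bsub>lin M\<^esub> emb M m \<in> carrier (lin M Mod W)" by (simp add: carrier_FactGroup)
    then have "Q.quot_act (W #>\<^bsub>lin M\<^esub> emb M m) (emb G \<gamma>) (emb A a) = \<one>\<^bsub>lin M Mod W\<^esub>"
      using ann c(2) by blast
    \<comment> \<open>Vanishing in the quotient means membership in \<open>W\<close>, and
      \<open>W\<close> meets \<open>M\<close> only in \<open>\<zero>\<close>.\<close>
    then have "emb M (act m \<gamma> a) \<in> W"
      using c m a by (simp add: Q.quot_act_coset lin_act_emb Q.coset_eq_one_iff
          M.emb_closed act_closed)
    then show ?thesis using W_emb act_closed m a by blast
  qed
  then have "{act m \<gamma> a |m \<gamma>. m \<in> carrier M \<and> \<gamma> \<in> carrier G} = {\<zero>\<^bsub>M\<^esub>}"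
    by (rule Collect_constant2[OF M.zero_closed G.zero_closed])
  then show ?thesis using a by (simp add: moduloid_ann_def)
qed

end


section \<open>Modules as moduloids\<close>

text \<open>Every addibility group is the whole of \<open>V\<close>, so submoduloids are closed
  under all differences and are subgroups. Nothing makes such moduloids regular, which is why the
  large radical appears in the comparison.\<close>

definition total_homogroupoid :: "'v monoid \<Rightarrow> 'v homogroupoid" where
  "total_homogroupoid V =
     \<lparr>carrier = carrier V, addable = (\<lambda>_ _. True), hadd = mult V, hzero = \<one>\<^bsub>V\<^esub>\<rparr>"

lemma total_homogroupoid_simps [simp]:
  "carrier (total_homogroupoid V) = carrier V" "x \<sharp>\<^bsub>total_homogroupoid V\<^esub> y"
  "x \<boxplus>\<^bsub>total_homogroupoid V\<^esub> y = x \<otimes>\<^bsub>V\<^esub> y" "\<zero>\<^bsub>total_homogroupoid V\<^esub> = \<one>\<^bsub>V\<^esub>"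
  by (simp_all add: total_homogroupoid_def)

lemma grp_on_total: "grp_on (total_homogroupoid V) (addible (total_homogroupoid V) a) =
    \<lparr>carrier = carrier V, mult = mult V, one = \<one>\<^bsub>V\<^esub>\<rparr>"
  by (simp add: grp_on_def addible_def total_homogroupoid_def)

lemma comm_homogroupoid_total:
  assumes "comm_group V" shows "comm_homogroupoid (total_homogroupoid V)"
proof -
  interpret V: comm_group V by (rule assms)
  show ?thesis
  proof (rule comm_homogroupoid.intro)
    show "group (grp_on (total_homogroupoid V) (addible (total_homogroupoid V) a))" for a
      by (rule groupI) (auto simp: grp_on_total V.m_assoc intro: V.l_inv_ex)
  qed (auto simp: V.m_comm)
qed

lemma hminus_total:
  assumes "comm_group V" "x \<in> carrier V" "y \<in> carrier V"
  shows "x \<boxminus>\<^bsub>total_homogroupoid V\<^esub> y = x \<otimes>\<^bsub>V\<^esub> inv\<^bsub>V\<^esub> y"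
proof -
  interpret V: comm_group V by (rule assms)
  interpret T: comm_homogroupoid "total_homogroupoid V" by (rule comm_homogroupoid_total[OF assms(1)])
  have "hneg (total_homogroupoid V) y = inv\<^bsub>V\<^esub> y" by (rule T.hneg_eqI) (use assms in auto)
  then show ?thesis by (simp add: hminus_def)
qed

context anneid
begin

interpretation LA: comm_group "lin A" by (rule A.comm_group_lin)
interpretation LG: comm_group "lin G" by (rule G.comm_group_lin)

definition hom_act :: "('v \<Rightarrow> ('g set \<Rightarrow> 'g) \<Rightarrow> ('a set \<Rightarrow> 'a) \<Rightarrow> 'v) \<Rightarrow> 'v \<Rightarrow> 'g \<Rightarrow> 'a \<Rightarrow> 'v" where
  "hom_act act v \<gamma> a = act v (emb G \<gamma>) (emb A a)"

lemma moduloid_total: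
  assumes "gamma_module (lin A) (lin G) (lin_prod A G p) V act"
  shows "moduloid A G p (total_homogroupoid V) (hom_act act)"
proof -
  interpret V: gamma_module "lin A" "lin G" "lin_prod A G p" V act by (rule assms)
  interpret T: comm_homogroupoid "total_homogroupoid V"
    by (rule comm_homogroupoid_total) (rule V.V.comm_group_axioms)
  show ?thesis
    \<comment> \<open>Folding \<open>lin_prod_emb\<close> from right to left writes a product in
      \<open>A\<close> as a product in \<open>lin A\<close>, so that \<open>V.act_assoc\<close>
      applies.\<close>
    by unfold_locales
      (simp_all add: hom_act_def A.emb_closed G.emb_closed V.act_closed V.act_left V.act_right
        V.act_assoc A.emb_add p_closed flip: lin_prod_emb)
qed

text \<open>Every \<open>act v \<gamma> x\<close> is a finite sum of values at homogeneous
  arguments. This carries vanishing of the action, and closure of a subgroup under it, from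
  \<open>G\<close> and \<open>A\<close> to their linearizations.\<close>

lemma act_homogeneous_induct [consumes 4, case_names hom mult]:
  assumes gm: "gamma_module (lin A) (lin G) (lin_prod A G p) V act"
    and v: "v \<in> carrier V" and \<gamma>: "\<gamma> \<in> carrier (lin G)" and x: "x \<in> carrier (lin A)"
    and hom: "\<And>g a. \<lbrakk>g \<in> carrier G; a \<in> carrier A\<rbrakk> \<Longrightarrow> P (hom_act act v g a)"
    and mult: "\<And>u w. \<lbrakk>u \<in> carrier V; w \<in> carrier V; P u; P w\<rbrakk> \<Longrightarrow> P (u \<otimes>\<^bsub>V\<^esub> w)"
  shows "P (act v \<gamma> x)"
proof -
  interpret V: gamma_module "lin A" "lin G" "lin_prod A G p" V act by (rule gm)
  show ?thesis using \<gamma>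
  proof (induction rule: G.lin_induct)
    case (emb g)
    show ?case using x
    proof (induction rule: A.lin_induct)
      case (emb a)
      then show ?case using hom[OF \<open>g \<in> _\<close>] by (simp add: hom_act_def)
    qed (simp add: V.act_right V.act_closed v G.emb_closed \<open>g \<in> _\<close> mult)
  qed (simp add: V.act_middle V.act_closed v x mult)
qed

lemma irreducible_moduloid_total:
  assumes irr: "irreducible_gamma_module (lin A) (lin G) (lin_prod A G p) V act"
  shows "irreducible_moduloid A G p (total_homogroupoid V) (hom_act act)"
  unfolding irreducible_moduloid_def
proof (intro conjI allI impI)
  have gm: "gamma_module (lin A) (lin G) (lin_prod A G p) V act"
    using irr by (simp add: irreducible_gamma_module_def)
  interpret V: gamma_module "lin A" "lin G" "lin_prod A G p" V act by (rule gm)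
  let ?T = "total_homogroupoid V"
  show "moduloid A G p ?T (hom_act act)" by (rule moduloid_total[OF gm])
  show "{hom_act act w \<alpha> a |w \<alpha> a. w \<in> carrier ?T \<and> \<alpha> \<in> carrier G \<and> a \<in> carrier A} \<noteq> {\<zero>\<^bsub>?T\<^esub>}"
  proof
    assume "{hom_act act w \<alpha> a |w \<alpha> a. w \<in> carrier ?T \<and> \<alpha> \<in> carrier G \<and> a \<in> carrier A} = {\<zero>\<^bsub>?T\<^esub>}"
    then have *: "hom_act act w \<alpha> a = \<one>\<^bsub>V\<^esub>"
      if "w \<in> carrier V" "\<alpha> \<in> carrier G" "a \<in> carrier A" for w \<alpha> a
      using that by auto
    have "act v \<gamma> x = \<one>\<^bsub>V\<^esub>"
      if "v \<in> carrier V" "\<gamma> \<in> carrier (lin G)" "x \<in> carrier (lin A)" for v \<gamma> x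
      using gm that by (rule act_homogeneous_induct) (use that * in auto)
    then have "{act v \<gamma> x |v \<gamma> x. v \<in> carrier V \<and> \<gamma> \<in> carrier (lin G) \<and> x \<in> carrier (lin A)} =
        {\<one>\<^bsub>V\<^esub>}"
      by (rule Collect_constant3[OF V.V.one_closed LG.one_closed LA.one_closed])
    then show False using irr by (simp add: irreducible_gamma_module_def)
  qed
  fix N assume N: "submoduloid N A G ?T (hom_act act)"
  have N_sub: "N \<subseteq> carrier V" and "N \<noteq> {}" using N by (auto simp: submoduloid_def)
  \<comment> \<open>Total addability removes the side condition on differences, leaving the usual
    subgroup criterion.\<close>
  have diff: "x \<otimes>\<^bsub>V\<^esub> inv\<^bsub>V\<^esub> y \<in> N" if "x \<in> N" "y \<in> N" for x y
  proof -
    have "x \<boxminus>\<^bsub>?T\<^esub> y \<in> N" using N that by (simp add: submoduloid_def)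
    moreover have "x \<in> carrier V" "y \<in> carrier V" using that N_sub by blast+
    ultimately show ?thesis by (simp add: hminus_total[OF V.V.comm_group_axioms])
  qed
  obtain n where "n \<in> N" using \<open>N \<noteq> {}\<close> by blast
  then have one: "\<one>\<^bsub>V\<^esub> \<in> N" using diff[of n n] N_sub by auto
  have inv: "inv\<^bsub>V\<^esub> y \<in> N" if "y \<in> N" for y
    using diff[OF one that] that N_sub by auto
  have mult: "x \<otimes>\<^bsub>V\<^esub> y \<in> N" if "x \<in> N" "y \<in> N" for x y
    using diff[OF that(1) inv[OF that(2)]] that N_sub by auto
  have "subgroup N V" by (rule V.V.subgroupI) (use N_sub \<open>N \<noteq> {}\<close> inv mult in auto)
  moreover have "act u \<gamma> x \<in> N"
    if u: "u \<in> N" "\<gamma> \<in> carrier (lin G)" "x \<in> carrier (lin A)" for u \<gamma> x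
    using gm _ u(2,3)
    by (rule act_homogeneous_induct) (use u N N_sub mult in \<open>auto simp: submoduloid_def\<close>)
  ultimately have "gamma_submodule N (lin A) (lin G) V act" by (simp add: gamma_submodule_def)
  then show "N = {\<zero>\<^bsub>?T\<^esub>} \<or> N = carrier ?T"
    using irr by (simp add: irreducible_gamma_module_def)
qed

text \<open>As \<open>emb A a\<close> is already homogeneous, only the variable in
  \<open>lin G\<close> has to be decomposed.\<close>

lemma large_jacobson_radical_emb_ann:
  assumes a: "a \<in> large_jacobson_radical A G p"
    and irr: "irreducible_gamma_module (lin A) (lin G) (lin_prod A G p) V act"
  shows "emb A a \<in> gamma_module_ann (lin A) (lin G) V act"
proof -
  interpret V: gamma_module "lin A" "lin G" "lin_prod A G p" V act
    using irr by (simp add: irreducible_gamma_module_def)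
  have "a \<in> moduloid_ann A G (total_homogroupoid V) (hom_act act)"
    using large_jacobson_radical_any_type[OF a irreducible_moduloid_total[OF irr]] .
  then have A: "a \<in> carrier A"
    and "{hom_act act w \<alpha> a |w \<alpha>. w \<in> carrier V \<and> \<alpha> \<in> carrier G} = {\<one>\<^bsub>V\<^esub>}"
    by (simp_all add: moduloid_ann_def)
  then have *: "act v (emb G g) (emb A a) = \<one>\<^bsub>V\<^esub>" if "v \<in> carrier V" "g \<in> carrier G" for v g
    using that by (auto simp: hom_act_def)
  have "act v \<gamma> (emb A a) = \<one>\<^bsub>V\<^esub>" if v: "v \<in> carrier V" and "\<gamma> \<in> carrier (lin G)" for v \<gamma>
    using that(2)
    by (induction rule: G.lin_induct) (simp_all add: * v V.act_middle A.emb_closed A)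
  then have "{act v \<gamma> (emb A a) |v \<gamma>. v \<in> carrier V \<and> \<gamma> \<in> carrier (lin G)} = {\<one>\<^bsub>V\<^esub>}"
    by (rule Collect_constant2[OF V.V.one_closed LG.one_closed])
  then show ?thesis using A.emb_closed[OF A] by (simp add: gamma_module_ann_def)
qed

end

section \<open>Comparison of the radicals\<close>

theorem proposition8p1:
  fixes A :: "'a homogroupoid" and G :: "'g homogroupoid" and p :: "'a \<Rightarrow> 'g \<Rightarrow> 'a \<Rightarrow> 'a"
  assumes "anneid A G p"
  shows "emb A ` large_jacobson_radical A G p =
           gamma_jacobson_radical (lin A) (lin G) (lin_prod A G p) \<inter> emb A ` carrier A \<and>
         large_jacobson_radical A G p \<subseteq> jacobson_radical A G p"
proof (intro conjI subset_antisym subsetI)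
  interpret anneid A G p by (rule assms)
  fix y assume "y \<in> emb A ` large_jacobson_radical A G p"
  then obtain a where a: "a \<in> large_jacobson_radical A G p" "y = emb A a" by blast
  then have "a \<in> carrier A" by (simp add: large_jacobson_radical_def)
  then show "y \<in> gamma_jacobson_radical (lin A) (lin G) (lin_prod A G p) \<inter> emb A ` carrier A"
    using large_jacobson_radical_emb_ann[OF a(1)] a(2) A.emb_closed
    by (auto simp: gamma_jacobson_radical_def)
next
  fix y assume "y \<in> gamma_jacobson_radical (lin A) (lin G) (lin_prod A G p) \<inter> emb A ` carrier A"
  then obtain a where a: "a \<in> carrier A" "y = emb A a"
    and J: "emb A a \<in> gamma_jacobson_radical (lin A) (lin G) (lin_prod A G p)" by blast
  have "a \<in> moduloid_ann A G M act"
    if irr: "irreducible_moduloid A G p M act" for M :: "'a list homogroupoid" and act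
  proof -
    interpret moduloid A G p M act using irr by (simp add: irreducible_moduloid_def)
    \<comment> \<open>Irreducibility supplies the additivity in \<open>G\<close> that the linearized
      action requires.\<close>
    interpret lin_moduloid A G p M act
      by unfold_locales (rule irreducible_emb_act_middle[OF irr])
    show ?thesis using gamma_jacobson_radical_ann[OF irr a(1) J] .
  qed
  then show "y \<in> emb A ` large_jacobson_radical A G p"
    using a by (auto simp: large_jacobson_radical_def)
next
  fix a assume "a \<in> large_jacobson_radical A G p"
  \<comment> \<open>The smaller radical imposes annihilation on all irreducible moduloids, in
    particular on the regular ones.\<close>
  then show "a \<in> jacobson_radical A G p"
    by (auto simp: large_jacobson_radical_def jacobson_radical_def)
qed

end
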